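(* Let $(T,\ell)$ be a pair consisting of a rooted tree $T$ (not necessarily locally finite) and a length function $\ell$ on $T$, with metric realization $\Gamma$. Then the sequence $(a_n)$ produced by the greedy procedure depends only on $\Gamma$. That is: if $(T_1,\ell_1)$ and $(T_2,\ell_2)$ are two such pairs whose metric realizations are isometric by a root-preserving isometry (possibly $(T_1,\ell_1)=(T_2,\ell_2)$), and if $(\rho_n)$ and $(\rho'_n)$ are any sequences produced by the greedy procedure for $(T_1,\ell_1)$ and $(T_2,\ell_2)$ respectively, each continued as long as possible, then the associated sequences $(a_n)$ and $(a'_n)$ have the same (finite or infinite) length and $a_n=a'_n$ for every index $n$.
   Context: A rooted tree $T$ has root $\mathfrak r$; its edges are oriented away from the root and $E(T)$ denotes the set of oriented edges. A length function is a map $\ell:E(T)\to\mathbb R_{+}$ with (strictly) positive values. The metric realization $\Gamma$ of $(T,\ell)$ is the rooted metric tree obtained by replacing each edge $e$ with an interval of length $\ell(e)$ glued at its end-vertices, equipped with the path metric and rooted at $\mathfrak r$. A leaf of $T$ is a vertex $v\ne\mathfrak r$ of valence one; if $T$ consists of the single vertex $\mathfrak r$, then $\mathfrak r$ is a leaf. The boundary $\partial T$ is the set of infinite oriented paths starting at $\mathfrak r$. The extended boundary $\widetilde\partial T$ is the union of $\partial T$ and the set of oriented paths from $\mathfrak r$ to a leaf. For $\rho\in\widetilde\partial T$, $E(\rho)$ is the set of edges of $\rho$. For $\rho,\tau\in\widetilde\partial T$ (with $\rho\neq\tau$ if both are in $\partial T$), set $\langle\rho,\tau\rangle:=\sum_{e\in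 E(\rho)\cap E(\tau)}\ell(e)$. Greedy procedure: choose $\rho_0\in\widetilde\partial T$ arbitrarily and put $a_0=0$. Given $\rho_0,\dots,\rho_{n-1}$, choose, if possible, $\rho_n$ arbitrarily among the elements $\rho\in\widetilde\partial T\setminus\{\rho_0,\dots,\rho_{n-1}\}$ which minimize $\sum_{j=0}^{n-1}\langle\rho,\rho_j\rangle$, and set $a_n:=\sum_{j=0}^{n-1}\langle\rho_n,\rho_j\rangle$. If $\widetilde\partial T\setminus\{\rho_0,\dots,\rho_{n-1}\}$ is empty, the procedure stops. *)

theory Defs
  imports Complex_Main "HOL-Library.Extended_Nat"
begin

section \<open>Rooted trees\<close>

text \<open>
  Vertex sets may be infinite, of any cardinality and any valences; edges are unordered pairs of
  distinct vertices.
\<close>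

record 'v rooted_graph =
  vertices :: "'v set"
  edges :: "'v set set"
  tree_root :: 'v

definition simple_path :: "'v rooted_graph \<Rightarrow> 'v list \<Rightarrow> bool" where
  "simple_path T p \<longleftrightarrow> p \<noteq> [] \<and> set p \<subseteq> vertices T \<and> distinct p \<and>
     successively (\<lambda>u v. {u, v} \<in> edges T) p"

definition graph_cycle :: "'v rooted_graph \<Rightarrow> 'v list \<Rightarrow> bool" where
  "graph_cycle T p \<longleftrightarrow> simple_path T p \<and> 3 \<le> length p \<and> {last p, hd p} \<in> edges T"

definition rooted_tree :: "'v rooted_graph \<Rightarrow> bool" where
  "rooted_tree T \<longleftrightarrow>
     edges T \<subseteq> {{u, v} | u v. u \<in> vertices T \<and> v \<in> vertices T \<and> u \<noteq> v} \<and>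
     tree_root T \<in> vertices T \<and>
     (\<forall>u \<in> vertices T. \<forall>v \<in> vertices T. \<exists>p. simple_path T p \<and> hd p = u \<and> last p = v) \<and>
     (\<nexists>p. graph_cycle T p)"

text \<open>
  The edge \<open>{u, v}\<close> is oriented from \<open>u\<close> to \<open>v\<close> if it is the last step of the simple path from
  the root to \<open>v\<close>.
\<close>

definition oriented_edges :: "'v rooted_graph \<Rightarrow> ('v \<times> 'v) set" where
  "oriented_edges T = {(u, v). \<exists>p. simple_path T (p @ [u, v]) \<and> hd (p @ [u, v]) = tree_root T}"

text \<open>Only the values of a length function on oriented edges are ever used.\<close>

definition length_function :: "'v rooted_graph \<Rightarrow> ('v \<times> 'v \<Rightarrow> real) \<Rightarrow> bool" where
  "length_function T l \<longleftrightarrow> (\<forall>e \<in> oriented_edges T. 0 < l e)"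

section \<open>The metric realization\<close>

text \<open>
  A point of the metric realization is a vertex or an interior point of the interval
  \<open>[0, l (u, v)]\<close> attached to an oriented edge \<open>(u, v)\<close>, where \<open>0\<close> is glued to \<open>u\<close> and
  \<open>l (u, v)\<close> is glued to \<open>v\<close>. The function \<open>edge_point l e\<close> is the gluing map of this interval.
\<close>

datatype 'v point = Vertex 'v | Interior "'v \<times> 'v" real

definition realization :: "'v rooted_graph \<Rightarrow> ('v \<times> 'v \<Rightarrow> real) \<Rightarrow> 'v point set" where
  "realization T l = Vertex ` vertices T \<union>
     {Interior e t | e t. e \<in> oriented_edges T \<and> 0 < t \<and> t < l e}"

definition edge_point :: "('v \<times> 'v \<Rightarrow> real) \<Rightarrow> 'v \<times> 'v \<Rightarrow> real \<Rightarrow> 'v point" where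
  "edge_point l e t =
     (if t = 0 then Vertex (fst e) else if t = l e then Vertex (snd e) else Interior e t)"

text \<open>
  A piecewise linear path is a list of segments \<open>(e, s, t)\<close>, each running inside the closed edge
  \<open>e\<close> from parameter \<open>s\<close> to parameter \<open>t\<close> (\<open>s \<ge> t\<close> being allowed). The path metric is the infimum
  of the lengths of the piecewise linear paths between two points.
\<close>

fun pl_path ::
  "'v rooted_graph \<Rightarrow> ('v \<times> 'v \<Rightarrow> real) \<Rightarrow>
     'v point \<Rightarrow> (('v \<times> 'v) \<times> real \<times> real) list \<Rightarrow> 'v point \<Rightarrow> bool" where
  "pl_path T l x [] y \<longleftrightarrow> x = y"
| "pl_path T l x ((e, s, t) # c) y \<longleftrightarrow>
     e \<in> oriented_edges T \<and> s \<in> {0..l e} \<and> t \<in> {0..l e} \<and>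
     x = edge_point l e s \<and> pl_path T l (edge_point l e t) c y"

definition pl_length :: "(('v \<times> 'v) \<times> real \<times> real) list \<Rightarrow> real" where
  "pl_length c = (\<Sum>(e, s, t) \<leftarrow> c. \<bar>s - t\<bar>)"

definition path_dist ::
  "'v rooted_graph \<Rightarrow> ('v \<times> 'v \<Rightarrow> real) \<Rightarrow> 'v point \<Rightarrow> 'v point \<Rightarrow> real" where
  "path_dist T l x y = Inf {pl_length c | c. pl_path T l x c y}"

definition root_isometric ::
  "'v rooted_graph \<Rightarrow> ('v \<times> 'v \<Rightarrow> real) \<Rightarrow>
   'w rooted_graph \<Rightarrow> ('w \<times> 'w \<Rightarrow> real) \<Rightarrow> bool" where
  "root_isometric T1 l1 T2 l2 \<longleftrightarrow>
     (\<exists>f. bij_betw f (realization T1 l1) (realization T2 l2) \<and>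
          (\<forall>x \<in> realization T1 l1. \<forall>y \<in> realization T1 l1.
             path_dist T2 l2 (f x) (f y) = path_dist T1 l1 x y) \<and>
          f (Vertex (tree_root T1)) = Vertex (tree_root T2))"

section \<open>The extended boundary\<close>

definition leaf :: "'v rooted_graph \<Rightarrow> 'v \<Rightarrow> bool" where
  "leaf T v \<longleftrightarrow> v \<in> vertices T \<and>
     (if v = tree_root T then vertices T = {tree_root T} else card {e \<in> edges T. v \<in> e} = 1)"

text \<open>Oriented paths, infinite or finite, are represented by their sequences of vertices.\<close>

datatype 'v oriented_path = Ray "nat \<Rightarrow> 'v" | Segment "'v list"

definition boundary :: "'v rooted_graph \<Rightarrow> 'v oriented_path set" where
  "boundary T = {Ray x | x. x 0 = tree_root T \<and> (\<forall>i. (x i, x (Suc i)) \<in> oriented_edges T)}"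

definition extended_boundary :: "'v rooted_graph \<Rightarrow> 'v oriented_path set" where
  "extended_boundary T = boundary T \<union>
     {Segment p | p. p \<noteq> [] \<and> hd p = tree_root T \<and> leaf T (last p) \<and>
        successively (\<lambda>u v. (u, v) \<in> oriented_edges T) p}"

fun path_edges :: "'v oriented_path \<Rightarrow> ('v \<times> 'v) set" where
  "path_edges (Ray x) = range (\<lambda>i. (x i, x (Suc i)))"
| "path_edges (Segment p) = set (zip p (tl p))"

text \<open>
  The sum ranges over a finite set unless \<open>\<rho>\<close> and \<open>\<tau>\<close> are the same ray; that case never occurs in
  the greedy procedure, which always pairs distinct elements.
\<close>

definition pairing ::
  "('v \<times> 'v \<Rightarrow> real) \<Rightarrow> 'v oriented_path \<Rightarrow> 'v oriented_path \<Rightarrow> real" where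
  "pairing l \<rho> \<tau> = (\<Sum>e \<in> path_edges \<rho> \<inter> path_edges \<tau>. l e)"

section \<open>The greedy procedure\<close>

definition greedy_choices ::
  "'v rooted_graph \<Rightarrow> ('v \<times> 'v \<Rightarrow> real) \<Rightarrow>
     (nat \<Rightarrow> 'v oriented_path) \<Rightarrow> nat \<Rightarrow> 'v oriented_path set" where
  "greedy_choices T l \<rho> n =
     Collect (is_arg_min (\<lambda>\<sigma>. \<Sum>j<n. pairing l \<sigma> (\<rho> j))
                         (\<lambda>\<sigma>. \<sigma> \<in> extended_boundary T - \<rho> ` {..<n}))"

text \<open>
  \<open>greedy_run T l \<rho> N\<close>: the terms \<open>\<rho> n\<close> with \<open>n < N\<close> form a sequence of length \<open>N\<close> (possibly \<open>\<infinity>\<close>)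
  produced by the greedy procedure and continued as long as a choice is possible. The terms
  \<open>\<rho> n\<close> with \<open>n \<ge> N\<close> are irrelevant.
\<close>

definition greedy_run ::
  "'v rooted_graph \<Rightarrow> ('v \<times> 'v \<Rightarrow> real) \<Rightarrow>
     (nat \<Rightarrow> 'v oriented_path) \<Rightarrow> enat \<Rightarrow> bool" where
  "greedy_run T l \<rho> N \<longleftrightarrow>
     (\<forall>n. enat n < N \<longrightarrow> \<rho> n \<in> greedy_choices T l \<rho> n) \<and>
     (\<forall>n. N = enat n \<longrightarrow> greedy_choices T l \<rho> n = {})"

definition greedy_value ::
  "('v \<times> 'v \<Rightarrow> real) \<Rightarrow> (nat \<Rightarrow> 'v oriented_path) \<Rightarrow> nat \<Rightarrow> real" where
  "greedy_value l \<rho> n = (\<Sum>j<n. pairing l (\<rho> n) (\<rho> j))"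

end

theory Submission
  imports Defs
begin

text \<open>
  The pairing is an ultrametric Gromov product on the extended boundary. For such a pairing, any
  finite set \<open>Y\<close> with more elements than \<open>X\<close> contains a point outside \<open>X\<close> whose pairings with
  the rest of \<open>Y\<close> sum to at least as much as those with \<open>X\<close>. Removing such points from \<open>Y\<close> one by
  one, with \<open>X\<close> an initial piece of a greedy sequence, shows, as for Bhargava's \<open>p\<close>-orderings, that
  \<open>a\<^sub>0 + \<dots> + a\<^sub>n\<close> is the least energy (the sum of the pairings over all pairs) of a set of \<open>n + 1\<close>
  elements of the extended boundary. The latter depends only on the extended boundary with its
  pairing, which the metric determines: the elements are the maximal chains of the order
  \<open>d(r, y) = d(r, x) + d(x, y)\<close> on \<open>\<Gamma>\<close>, and the pairing of two of them is the greatest height of a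
  common point. A greedy choice exists as long as the extended boundary is not exhausted, because
  the pairings with a fixed element are well-ordered.
\<close>

section \<open>Greedy sequences in ultrametric pairings\<close>

text \<open>Ties let two runs make unrelated choices, and the minimum defining a single a_n refers
  to the earlier choices. The partial sums, being minima of energies, do not; a_n is recovered as a
  difference of consecutive minima. An isometry need not respect vertices, since a non-root vertex
  of valence two is invisible in the metric, so the transfer cannot follow edges and works with
  points of \<open>\<Gamma>\<close>. It suffices to build an injection of extended boundaries that
  does not increase pairings: pushing sets forward bounds one minimal energy by the other, and the
  inverse isometry gives the converse. The infimum in \<open>path_dist\<close> is controlled by
  coordinates along the edges; recovering the order takes exact distances between comparable points
  and a lower bound for all others. Distinctness in \<open>separated_ultrametric\<close> excludes
  \<open>x = z\<close>, where \<open>p x y\<close> would be bounded by a self-pairing: for a ray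
  this is a sum over an infinite set, hence \<open>0\<close> in HOL.\<close>

definition separated_ultrametric :: "'a set \<Rightarrow> ('a \<Rightarrow> 'a \<Rightarrow> real) \<Rightarrow> bool" where
  "separated_ultrametric B p \<longleftrightarrow>
     (\<forall>x\<in>B. \<forall>y\<in>B. 0 \<le> p x y \<and> p x y = p y x) \<and>
     (\<forall>x\<in>B. \<forall>y\<in>B. \<forall>z\<in>B. x \<noteq> y \<longrightarrow> y \<noteq> z \<longrightarrow> x \<noteq> z \<longrightarrow> min (p x y) (p y z) \<le> p x z)"

text \<open>The map \<open>t \<mapsto> max (t - m) 0\<close> is monotone and nonnegative, hence
  respects minima and symmetry.\<close>

lemma separated_ultrametric_truncate:
  assumes "separated_ultrametric B p"
  shows "separated_ultrametric B (\<lambda>x y. max (p x y - m) 0)"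
  unfolding separated_ultrametric_def
proof (intro conjI ballI impI)
  fix x y z assume B: "x \<in> B" "y \<in> B" "z \<in> B" and "x \<noteq> y" "y \<noteq> z" "x \<noteq> z"
  then have "min (p x y) (p y z) \<le> p x z"
    using assms unfolding separated_ultrametric_def by blast
  then show "min (max (p x y - m) 0) (max (p y z - m) 0) \<le> max (p x z - m) 0"
    by (auto simp: min_def max_def)
next
  fix x y assume "x \<in> B" "y \<in> B"
  then show "max (p x y - m) 0 = max (p y x - m) 0"
    using assms unfolding separated_ultrametric_def by metis
qed auto

text \<open>
  Let \<open>m\<close> be the least pairing inside \<open>Y\<close>. Either the ball of points pairing to more than \<open>m\<close> with
  some point of \<open>Y\<close> or its complement meets \<open>Y\<close> in more points than \<open>X\<close>. The induction passes to
  that part and to the pairing truncated at \<open>m\<close>, which vanishes across the two parts.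
\<close>

lemma ultrametric_exchange:
  assumes "separated_ultrametric B p" "finite X" "finite Y" "X \<subseteq> B" "Y \<subseteq> B" "card X < card Y"
  shows "\<exists>y\<in>Y - X. (\<Sum>x\<in>X. p y x) \<le> (\<Sum>z\<in>Y - {y}. p y z)"
  using assms
proof (induction "card Y" arbitrary: X Y p rule: less_induct)
  case less
  note um = less.prems(1) and fin = less.prems(2,3) and sub = less.prems(4,5) and
    card_less = less.prems(6)
  have sym: "p x y = p y x" if "x \<in> B" "y \<in> B" for x y
    using um that unfolding separated_ultrametric_def by blast
  have um3: "min (p x y) (p y z) \<le> p x z"
    if "x \<in> B" "y \<in> B" "z \<in> B" "x \<noteq> y" "y \<noteq> z" "x \<noteq> z" for x y z
    using um that unfolding separated_ultrametric_def by blast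
  show ?case
  proof (cases "card Y = 1")
    case True
    then obtain y where "Y = {y}"
      by (auto simp: card_1_singleton_iff)
    moreover have "X = {}"
      using card_less True fin by simp
    ultimately show ?thesis by simp
  next
    case False
    define Q where "Q = {(y, z). y \<in> Y \<and> z \<in> Y \<and> y \<noteq> z}"
    have "\<exists>y z. y \<in> Y \<and> z \<in> Y \<and> y \<noteq> z"
    proof (rule ccontr)
      assume "\<not> ?thesis"
      then have "card Y \<le> 1"
        using fin(2) by (metis One_nat_def card_le_Suc0_iff_eq)
      then show False
        using False card_less by simp
    qed
    then have "Q \<noteq> {}"
      by (auto simp: Q_def)
    moreover have "finite Q"
      using fin(2) finite_subset[of Q "Y \<times> Y"] by (auto simp: Q_def)
    ultimately obtain y0 y1 where y01: "(y0, y1) \<in> Q"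
      and "\<forall>q\<in>Q. p y0 y1 \<le> case_prod p q"
      using ex_min_if_finite[of "case_prod p ` Q"] by (force simp: not_less)
    then have min: "p y0 y1 \<le> p y z" if "y \<in> Y" "z \<in> Y" "y \<noteq> z" for y z
      using that by (auto simp: Q_def)
    define m where "m = p y0 y1"
    define C where "C = {z. z = y0 \<or> m < p y0 z}"
    have y: "y0 \<in> Y" "y1 \<in> Y" "y0 \<noteq> y1"
      using y01 by (auto simp: Q_def)
    have m0: "0 \<le> m"
      using um y sub unfolding m_def separated_ultrametric_def by blast
    \<comment> \<open>Since \<open>p y0 z\<close> exceeds \<open>m\<close> while
      \<open>p y0 w\<close> does not, the ultrametric inequality through \<open>z\<close> leaves
      only \<open>p z w \<le> m\<close>.\<close>
    have across: "p z w \<le> m" if "z \<in> B" "w \<in> B" "z \<in> C" "w \<notin> C" for z w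
    proof (cases "z = y0")
      case True
      then show ?thesis
        using that by (auto simp: C_def)
    next
      case False
      then have "min (p y0 z) (p z w) \<le> p y0 w"
        using that y sub by (intro um3) (auto simp: C_def)
      then show ?thesis
        using that False by (auto simp: C_def)
    qed
    have "card (X \<inter> C) + card (X - C) < card (Y \<inter> C) + card (Y - C)"
      using card_less fin by (metis card_Int_Diff)
    then have "card (X \<inter> C) < card (Y \<inter> C) \<or> card (X \<inter> - C) < card (Y \<inter> - C)"
      by (auto simp: Diff_eq)
    then obtain D where D: "D = C \<or> D = - C" and D_card: "card (X \<inter> D) < card (Y \<inter> D)"
      by blast
    have across_D: "p z w \<le> m" if "z \<in> B" "w \<in> B" "z \<in> D" "w \<notin> D" for z w
      using that across[of z w] across[of w z] sym[of z w] D by auto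
    \<comment> \<open>Both parts meet \<open>Y\<close>, so whichever is kept is strictly smaller and
      the induction applies.\<close>
    have "y0 \<in> C" "y1 \<notin> C"
      using y by (auto simp: C_def m_def)
    then have "Y \<inter> D \<subset> Y"
      using D y by auto
    then have "card (Y \<inter> D) < card Y"
      using fin by (simp add: psubset_card_mono)
    from less.hyps[OF this separated_ultrametric_truncate[OF um, of m] _ _ _ _ D_card] fin sub
    obtain y where yD: "y \<in> Y \<inter> D" "y \<notin> X"
      and le: "(\<Sum>x\<in>X \<inter> D. max (p y x - m) 0) \<le> (\<Sum>z\<in>Y \<inter> D - {y}. max (p y z - m) 0)"
      by fastforce
    have yB: "y \<in> B"
      using yD sub by auto
    \<comment> \<open>Truncation loses at most \<open>m\<close> per point of \<open>X\<close> and
      exactly \<open>m\<close> per other point of \<open>Y\<close>, by minimality of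
      \<open>m\<close>; across the two parts truncated pairings vanish. The remaining multiples of
      \<open>m\<close> compare because \<open>card X \<le> card (Y - {y})\<close>.\<close>
    have "(\<Sum>x\<in>X. p y x) \<le> (\<Sum>x\<in>X. max (p y x - m) 0 + m)"
      by (intro sum_mono) auto
    also have "\<dots> = (\<Sum>x\<in>X. max (p y x - m) 0) + card X * m"
      by (simp add: sum.distrib)
    also have "(\<Sum>x\<in>X. max (p y x - m) 0) = (\<Sum>x\<in>X \<inter> D. max (p y x - m) 0)"
      using fin sub yD yB across_D by (intro sum.mono_neutral_right) (auto simp: max_def subset_iff)
    also note le
    also have "(\<Sum>z\<in>Y \<inter> D - {y}. max (p y z - m) 0) \<le> (\<Sum>z\<in>Y - {y}. max (p y z - m) 0)"
      using fin by (intro sum_mono2) auto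
    also have "\<dots> = (\<Sum>z\<in>Y - {y}. p y z - m)"
    proof (rule sum.cong[OF refl])
      fix z assume "z \<in> Y - {y}"
      then show "max (p y z - m) 0 = p y z - m"
        using min[of y z] yD by (auto simp: m_def)
    qed
    also have "\<dots> = (\<Sum>z\<in>Y - {y}. p y z) - card (Y - {y}) * m"
      by (simp add: sum_subtractf)
    finally have "(\<Sum>x\<in>X. p y x) \<le> (\<Sum>z\<in>Y - {y}. p y z) - card (Y - {y}) * m + card X * m"
      by simp
    moreover have "card X * m \<le> card (Y - {y}) * m"
      using card_less m0 yD fin by (intro mult_right_mono) auto
    ultimately show ?thesis
      using yD by (intro bexI[of _ y]) auto
  qed
qed

section \<open>Energy of finite sets and greedy sums\<close>

definition energy :: "('a \<Rightarrow> 'a \<Rightarrow> real) \<Rightarrow> 'a set \<Rightarrow> real" where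
  "energy p Y = (\<Sum>y\<in>Y. \<Sum>z\<in>Y - {y}. p y z) / 2"

text \<open>Removing \<open>y\<close> deletes its row and its column from the ordered double sum;
  symmetry makes them equal, which cancels the factor one half.\<close>

lemma energy_remove:
  assumes "finite Y" "y \<in> Y" and sym: "\<And>z. z \<in> Y \<Longrightarrow> p z y = p y z"
  shows "energy p Y = energy p (Y - {y}) + (\<Sum>z\<in>Y - {y}. p y z)"
proof -
  have "(\<Sum>z\<in>Y - {x}. p x z) = (\<Sum>z\<in>Y - {y} - {x}. p x z) + p y x" if "x \<in> Y - {y}" for x
  proof -
    have "Y - {x} = insert y (Y - {y} - {x})"
      using assms that by auto
    then show ?thesis
      using assms(1) that sym by simp
  qed
  then have "(\<Sum>x\<in>Y - {y}. \<Sum>z\<in>Y - {x}. p x z)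
      = (\<Sum>x\<in>Y - {y}. \<Sum>z\<in>Y - {y} - {x}. p x z) + (\<Sum>x\<in>Y - {y}. p y x)"
    by (simp add: sum.distrib)
  then show ?thesis
    using assms by (simp add: energy_def sum.remove[of Y y])
qed

lemma energy_greedy:
  fixes n :: nat
  assumes "separated_ultrametric B p" "inj_on \<rho> {..<n}" "\<rho> ` {..<n} \<subseteq> B"
  shows "energy p (\<rho> ` {..<n}) = (\<Sum>k<n. \<Sum>j<k. p (\<rho> k) (\<rho> j))"
  using assms(2,3)
proof (induction n)
  case 0
  then show ?case by (simp add: energy_def)
next
  case (Suc n)
  have inj: "inj_on \<rho> {..<n}"
    using Suc.prems(1) by (rule inj_on_subset) auto
  have "\<rho> n \<notin> \<rho> ` {..<n}"
    by (auto simp: inj_on_eq_iff[OF Suc.prems(1)])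
  then have eq: "\<rho> ` {..<Suc n} - {\<rho> n} = \<rho> ` {..<n}"
    by (auto simp: lessThan_Suc)
  have "energy p (\<rho> ` {..<Suc n}) = energy p (\<rho> ` {..<n}) + (\<Sum>z\<in>\<rho> ` {..<n}. p (\<rho> n) z)"
    using assms(1) Suc.prems(2) unfolding eq[symmetric] separated_ultrametric_def
    by (intro energy_remove) (simp_all add: subset_iff)
  also have "(\<Sum>z\<in>\<rho> ` {..<n}. p (\<rho> n) z) = (\<Sum>j<n. p (\<rho> n) (\<rho> j))"
    using inj by (simp add: sum.reindex)
  finally show ?case
    using Suc.IH[OF inj] Suc.prems(2) by (auto simp: lessThan_Suc)
qed

lemma greedy_le_energy:
  assumes um: "separated_ultrametric B p"
    and "inj_on \<rho> {..<n}" "\<rho> ` {..<n} \<subseteq> B"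
    and "\<And>k \<sigma>. k < n \<Longrightarrow> \<sigma> \<in> B - \<rho> ` {..<k} \<Longrightarrow>
      (\<Sum>j<k. p (\<rho> k) (\<rho> j)) \<le> (\<Sum>j<k. p \<sigma> (\<rho> j))"
    and "finite Y" "Y \<subseteq> B" "card Y = n"
  shows "(\<Sum>k<n. \<Sum>j<k. p (\<rho> k) (\<rho> j)) \<le> energy p Y"
  using assms(2-)
proof (induction n arbitrary: Y)
  case 0
  then show ?case by (simp add: energy_def)
next
  case (Suc n)
  have inj: "inj_on \<rho> {..<n}"
    using Suc.prems(1) by (rule inj_on_subset) auto
  have sub: "\<rho> ` {..<n} \<subseteq> B"
    using Suc.prems(2) by auto
  have "card (\<rho> ` {..<n}) < card Y"
    using inj Suc.prems(6) by (simp add: card_image)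
  then obtain y where y: "y \<in> Y" "y \<notin> \<rho> ` {..<n}"
    and le: "(\<Sum>x\<in>\<rho> ` {..<n}. p y x) \<le> (\<Sum>z\<in>Y - {y}. p y z)"
    using ultrametric_exchange[OF um _ \<open>finite Y\<close> sub \<open>Y \<subseteq> B\<close>] by auto
  \<comment> \<open>The exchanged point \<open>y\<close> was admissible when \<open>\<rho> n\<close>
    was chosen, so the greedy value is at most its sum.\<close>
  have "(\<Sum>j<n. p (\<rho> n) (\<rho> j)) \<le> (\<Sum>j<n. p y (\<rho> j))"
    using y Suc.prems(5) by (intro Suc.prems(3)) auto
  also have "\<dots> = (\<Sum>x\<in>\<rho> ` {..<n}. p y x)"
    using inj by (simp add: sum.reindex)
  also note le
  finally have "(\<Sum>j<n. p (\<rho> n) (\<rho> j)) \<le> (\<Sum>z\<in>Y - {y}. p y z)" .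
  moreover have "(\<Sum>k<n. \<Sum>j<k. p (\<rho> k) (\<rho> j)) \<le> energy p (Y - {y})"
    using inj sub Suc.prems y by (intro Suc.IH) auto
  moreover have "energy p Y = energy p (Y - {y}) + (\<Sum>z\<in>Y - {y}. p y z)"
    using um y Suc.prems(4,5) unfolding separated_ultrametric_def
    by (intro energy_remove) (blast+)
  ultimately show ?case by simp
qed

text \<open>
  On the points whose largest pairing with \<open>R\<close> is the one with \<open>\<rho>\<close>, the sum is a monotone function
  of the pairing with \<open>\<rho>\<close> alone.
\<close>

lemma ultrametric_minimizer_exists:
  assumes um: "separated_ultrametric B p" and R: "finite R" "R \<subseteq> B" and ne: "B - R \<noteq> {}"
    and wo: "\<And>\<rho> S. \<rho> \<in> B \<Longrightarrow> S \<subseteq> B - {\<rho>} \<Longrightarrow> S \<noteq> {} \<Longrightarrow> \<exists>\<sigma>\<in>S. \<forall>\<tau>\<in>S. p \<sigma> \<rho> \<le> p \<tau> \<rho>"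
  shows "\<exists>\<sigma>\<in>B - R. \<forall>\<tau>\<in>B - R. (\<Sum>\<rho>\<in>R. p \<sigma> \<rho>) \<le> (\<Sum>\<rho>\<in>R. p \<tau> \<rho>)"
proof (cases "R = {}")
  case True
  then show ?thesis
    using ne by auto
next
  case False
  have um3: "min (p x y) (p y z) \<le> p x z"
    if "x \<in> B" "y \<in> B" "z \<in> B" "x \<noteq> y" "y \<noteq> z" "x \<noteq> z" for x y z
    using um that unfolding separated_ultrametric_def by blast
  have sym: "p x y = p y x" if "x \<in> B" "y \<in> B" for x y
    using um that unfolding separated_ultrametric_def by blast
  define S where "S \<rho> = {\<sigma> \<in> B - R. \<forall>\<rho>'\<in>R. p \<sigma> \<rho>' \<le> p \<sigma> \<rho>}" for \<rho>
  define s where "s \<rho> = (SOME \<sigma>. \<sigma> \<in> S \<rho> \<and> (\<forall>\<tau>\<in>S \<rho>. p \<sigma> \<rho> \<le> p \<tau> \<rho>))" for \<rho>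
  define F where "F \<sigma> = (\<Sum>\<rho>\<in>R. p \<sigma> \<rho>)" for \<sigma>
  have S_cover: "\<exists>\<rho>\<in>R. \<tau> \<in> S \<rho>" if "\<tau> \<in> B - R" for \<tau>
  proof -
    have "\<exists>\<rho>\<in>R. \<forall>\<rho>'\<in>R. p \<tau> \<rho>' \<le> p \<tau> \<rho>"
      using ex_min_if_finite[of "(\<lambda>\<rho>. - p \<tau> \<rho>) ` R"] R False by (force simp: not_less)
    then show ?thesis
      using that by (auto simp: S_def)
  qed
  have s: "s \<rho> \<in> S \<rho> \<and> (\<forall>\<tau>\<in>S \<rho>. p (s \<rho>) \<rho> \<le> p \<tau> \<rho>)" if "\<rho> \<in> R" "S \<rho> \<noteq> {}" for \<rho>
  proof -
    have "\<exists>\<sigma>. \<sigma> \<in> S \<rho> \<and> (\<forall>\<tau>\<in>S \<rho>. p \<sigma> \<rho> \<le> p \<tau> \<rho>)"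
      using wo[of \<rho> "S \<rho>"] that R by (auto simp: S_def)
    then show ?thesis
      unfolding s_def by (rule someI_ex)
  qed
  have F_le: "F (s \<rho>) \<le> F \<tau>" if "\<rho> \<in> R" "\<tau> \<in> S \<rho>" for \<rho> \<tau>
    unfolding F_def
  proof (rule sum_mono)
    fix \<rho>' assume "\<rho>' \<in> R"
    have sS: "s \<rho> \<in> S \<rho>" and s_le: "p (s \<rho>) \<rho> \<le> p \<tau> \<rho>"
      using s[of \<rho>] that by auto
    show "p (s \<rho>) \<rho>' \<le> p \<tau> \<rho>'"
    proof (cases "\<rho>' = \<rho>")
      case True
      then show ?thesis
        using s_le by simp
    next
      case False
      \<comment> \<open>Both terms of the minimum dominate \<open>p (s \<rho>) \<rho>'\<close>: the
        first by the choice of \<open>s \<rho>\<close> and fact 3, the second by facts 2 and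
        3.\<close>
      then have 1: "min (p \<tau> \<rho>) (p \<rho> \<rho>') \<le> p \<tau> \<rho>'"
        using that \<open>\<rho>' \<in> R\<close> R by (intro um3) (auto simp: S_def)
      have 2: "min (p \<rho> (s \<rho>)) (p (s \<rho>) \<rho>') \<le> p \<rho> \<rho>'"
        using that \<open>\<rho>' \<in> R\<close> R sS False by (intro um3) (auto simp: S_def)
      have 3: "p (s \<rho>) \<rho>' \<le> p (s \<rho>) \<rho>"
        using sS \<open>\<rho>' \<in> R\<close> by (auto simp: S_def)
      have "p \<rho> (s \<rho>) = p (s \<rho>) \<rho>"
        using sS that R by (intro sym) (auto simp: S_def)
      then show ?thesis
        using 1 2 3 s_le by (auto simp: min_def split: if_splits)
    qed
  qed
  \<comment> \<open>One minimizer per nonempty cell \<open>S \<rho>\<close> leaves finitely many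
    candidates, and the cells cover \<open>B - R\<close>.\<close>
  define M where "M = s ` {\<rho> \<in> R. S \<rho> \<noteq> {}}"
  have "finite M" "M \<noteq> {}"
    using R ne S_cover by (auto simp: M_def)
  then obtain \<sigma> where \<sigma>: "\<sigma> \<in> M" "\<forall>\<tau>\<in>M. F \<sigma> \<le> F \<tau>"
    using ex_min_if_finite[of "F ` M"] by (force simp: not_less)
  have "\<sigma> \<in> B - R"
    using \<sigma>(1) s by (auto simp: M_def S_def)
  moreover have "F \<sigma> \<le> F \<tau>" if \<tau>: "\<tau> \<in> B - R" for \<tau>
  proof -
    obtain \<rho> where "\<rho> \<in> R" "\<tau> \<in> S \<rho>"
      using S_cover[OF \<tau>] by blast
    then have "F \<sigma> \<le> F (s \<rho>)"
      using \<sigma>(2) by (auto simp: M_def)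
    then show ?thesis
      using F_le[OF \<open>\<rho> \<in> R\<close> \<open>\<tau> \<in> S \<rho>\<close>] by simp
  qed
  ultimately show ?thesis
    unfolding F_def by blast
qed

section \<open>Orientation of a rooted tree\<close>

lemma simple_path_Cons:
  "simple_path T (u # p) \<longleftrightarrow>
     u \<in> vertices T \<and> u \<notin> set p \<and> (p = [] \<or> {u, hd p} \<in> edges T \<and> simple_path T p)"
  by (auto simp: simple_path_def successively_Cons)

lemma simple_path_append:
  "simple_path T (p @ q) \<longleftrightarrow>
     (if p = [] then simple_path T q else if q = [] then simple_path T p else
       simple_path T p \<and> simple_path T q \<and> set p \<inter> set q = {} \<and> {last p, hd q} \<in> edges T)"
  by (auto simp: simple_path_def successively_append_iff)

lemma simple_path_rev: "simple_path T (rev p) \<longleftrightarrow> simple_path T p"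
  by (auto simp: simple_path_def insert_commute)

text \<open>
  Where two paths diverge at \<open>u\<close>, following the first one until it meets the second one and
  returning along the latter yields a cycle.
\<close>

lemma simple_path_unique:
  assumes T: "\<nexists>p. graph_cycle T p"
    and "simple_path T p" "simple_path T q" "hd p = hd q" "last p = last q"
  shows "p = q"
  using assms(2-)
proof (induction p arbitrary: q)
  case Nil
  then show ?case by (simp add: simple_path_def)
next
  case (Cons u p)
  then obtain q' where q: "q = u # q'"
    by (cases q) (auto simp: simple_path_def)
  show ?case
  proof (cases "p = [] \<or> q' = []")
    case True
    then show ?thesis
      using Cons.prems q by (auto simp: simple_path_Cons split: if_splits)
  next
    case False
    then have p': "simple_path T p" "u \<notin> set p" "{u, hd p} \<in> edges T"
      and q': "simple_path T q'" "u \<notin> set q'" "{u, hd q'} \<in> edges T" "u \<in> vertices T"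
      and last: "last p = last q'"
      using Cons.prems q by (auto simp: simple_path_Cons)
    have "hd p = hd q'"
    proof (rule ccontr)
      assume ne: "hd p \<noteq> hd q'"
      have "\<exists>w\<in>set p. w \<in> set q'"
        using False last by (metis last_in_set)
      then obtain p1 w p2 where p: "p = p1 @ w # p2" and w: "w \<in> set q'"
        and p1: "\<forall>v\<in>set p1. v \<notin> set q'"
        by (rule split_list_first_propE)
      obtain q1 q2 where q1: "q' = q1 @ w # q2"
        using w by (meson split_list)
      let ?c = "u # p1 @ w # rev q1"
      have "simple_path T (p1 @ [w])"
        using p'(1) by (auto simp: p simple_path_append simple_path_Cons split: if_splits)
      moreover have "simple_path T (w # rev q1)"
        using q'(1) simple_path_rev[of T "q1 @ [w]"]
        by (auto simp: q1 simple_path_append simple_path_Cons split: if_splits)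
      moreover have "u \<notin> set (p1 @ w # rev q1)"
        using p'(2) q'(2) by (auto simp: p q1)
      moreover have "set p1 \<inter> set q1 = {}"
        using p1 q1 by auto
      moreover have "{u, hd (p1 @ [w])} \<in> edges T"
        using p'(3) by (cases p1) (auto simp: p)
      ultimately have "simple_path T ?c"
        using q'(4) by (cases p1) (auto simp: simple_path_Cons simple_path_append hd_append)
      moreover have "{last ?c, u} \<in> edges T"
        using q'(3) by (cases q1) (auto simp: q1 insert_commute)
      \<comment> \<open>As the second vertices differ, \<open>w\<close> cannot be second on both
        paths; this rules out a degenerate cycle of two vertices.\<close>
      moreover have "p1 \<noteq> [] \<or> q1 \<noteq> []"
        using ne by (auto simp: p q1)
      then have "3 \<le> length ?c"
        by (cases p1; cases q1) auto
      ultimately have "graph_cycle T ?c"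
        by (simp add: graph_cycle_def)
      then show False
        using T by blast
    qed
    then show ?thesis
      using Cons.IH[of q'] p' q' last q by simp
  qed
qed

locale oriented_tree =
  fixes T :: "'v rooted_graph"
  assumes rooted_tree: "rooted_tree T"
begin

abbreviation "E \<equiv> oriented_edges T"
abbreviation "r \<equiv> tree_root T"

lemma edge_vertices:
  assumes "{u, v} \<in> edges T"
  shows "u \<in> vertices T" "v \<in> vertices T" "u \<noteq> v"
  using assms rooted_tree unfolding rooted_tree_def by (auto simp: doubleton_eq_iff)

lemma root_vertex: "r \<in> vertices T"
  using rooted_tree by (simp add: rooted_tree_def)

lemma no_cycle: "\<not> graph_cycle T p"
  using rooted_tree by (simp add: rooted_tree_def)

lemma oriented_edgeE:
  assumes "(u, v) \<in> E"
  obtains p where "simple_path T (p @ [u, v])" "hd (p @ [u, v]) = r"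
  using assms by (auto simp: oriented_edges_def)

lemma parent_unique:
  assumes "(u, w) \<in> E" "(v, w) \<in> E"
  shows "u = v"
proof -
  obtain p q where "simple_path T (p @ [u, w])" "hd (p @ [u, w]) = r"
    and "simple_path T (q @ [v, w])" "hd (q @ [v, w]) = r"
    using assms by (metis oriented_edgeE)
  then have "p @ [u, w] = q @ [v, w]"
    using no_cycle by (intro simple_path_unique) auto
  then show ?thesis by simp
qed

lemma no_edge_to_root: "(u, r) \<notin> E"
proof
  assume "(u, r) \<in> E"
  then obtain p where "simple_path T (p @ [u, r])" "hd (p @ [u, r]) = r"
    by (rule oriented_edgeE)
  then show False
    by (cases p) (auto simp: simple_path_def)
qed

lemma simple_path_rtrancl:
  "simple_path T p \<Longrightarrow> hd p = r \<Longrightarrow> (r, last p) \<in> E\<^sup>*"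
proof (induction p rule: rev_induct)
  case (snoc v p)
  show ?case
  proof (cases p rule: rev_cases)
    case Nil
    then show ?thesis
      using snoc.prems by simp
  next
    case (snoc q u)
    then have "(u, v) \<in> E"
      using snoc.prems by (auto simp: oriented_edges_def intro!: exI[of _ q])
    moreover have "(r, u) \<in> E\<^sup>*"
      using snoc.prems snoc.IH snoc simple_path_append[of T p "[v]"]
      by (auto simp: hd_append split: if_splits)
    ultimately show ?thesis by simp
  qed
qed (simp add: simple_path_def)

text \<open>Replaces connectivity by reachability along \<open>E\<close>, on which induction from
  the root rests.\<close>

lemma vertices_iff: "v \<in> vertices T \<longleftrightarrow> (r, v) \<in> E\<^sup>*"
proof
  assume "v \<in> vertices T"
  then obtain p where "simple_path T p" "hd p = r" "last p = v"
    using rooted_tree root_vertex by (force simp: rooted_tree_def)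
  then show "(r, v) \<in> E\<^sup>*"
    using simple_path_rtrancl by metis
next
  assume "(r, v) \<in> E\<^sup>*"
  then show "v \<in> vertices T"
  proof (cases rule: rtrancl.cases)
    case (rtrancl_into_rtrancl u)
    then have "(u, v) \<in> E" by simp
    then show ?thesis
      by (auto elim!: oriented_edgeE simp: simple_path_def)
  qed (simp add: root_vertex)
qed

lemma parentE:
  assumes "v \<in> vertices T" "v \<noteq> r"
  obtains u where "(u, v) \<in> E"
proof -
  have "(r, v) \<in> E\<^sup>*"
    using assms(1) vertices_iff by simp
  then show ?thesis
    by (cases rule: rtrancl.cases) (use assms(2) that in auto)
qed

lemma oriented_edge_in_edges: "(u, v) \<in> E \<Longrightarrow> {u, v} \<in> edges T"
  by (auto elim!: oriented_edgeE simp: simple_path_append simple_path_Cons split: if_splits)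

text \<open>Extend the root path of \<open>v\<close> by \<open>w\<close>; if \<open>w\<close>
  already lies on it, the absence of cycles forces \<open>w\<close> to be the vertex just before
  \<open>v\<close>.\<close>

lemma edge_oriented:
  assumes "{v, w} \<in> edges T"
  shows "(w, v) \<in> E \<or> (v, w) \<in> E"
proof -
  note vw = edge_vertices[OF assms]
  obtain p where p: "simple_path T p" "hd p = r" "last p = v"
    using rooted_tree root_vertex vw by (force simp: rooted_tree_def)
  then have "p \<noteq> []"
    by (auto simp: simple_path_def)
  show ?thesis
  proof (cases "w \<in> set p")
    case True
    then obtain p1 q where pq: "p = p1 @ w # q"
      by (meson split_list)
    have "q \<noteq> []"
      using p pq vw by auto
    have "\<not> graph_cycle T (w # q)"
      by (rule no_cycle)
    moreover have "simple_path T (w # q)"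
      using p pq by (auto simp: simple_path_append split: if_splits)
    ultimately have "length (w # q) < 3"
      using p pq \<open>q \<noteq> []\<close> assms by (auto simp: graph_cycle_def)
    then have "q = [v]"
      using p pq \<open>q \<noteq> []\<close> by (cases q) (auto simp: Suc_le_eq)
    then show ?thesis
      using p pq by (auto simp: oriented_edges_def intro!: exI[of _ p1])
  next
    case False
    obtain q where q: "p = q @ [v]"
      using p \<open>p \<noteq> []\<close> by (metis append_butlast_last_id)
    have "simple_path T (p @ [w])"
      using p False vw assms \<open>p \<noteq> []\<close> by (auto simp: simple_path_append simple_path_Cons)
    then have "(v, w) \<in> E"
      using p q by (auto simp: oriented_edges_def hd_append intro!: exI[of _ q])
    then show ?thesis ..
  qed
qed

text \<open>Away from the root, the parent edge always contributes one to the valence, so valence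
  one means childless. The root has no parent edge, and is childless exactly in the one-vertex
  tree.\<close>

lemma leaf_iff: "leaf T v \<longleftrightarrow> v \<in> vertices T \<and> (\<forall>w. (v, w) \<notin> E)"
proof (cases "v = r")
  case True
  have "vertices T = {r} \<longleftrightarrow> (\<forall>w. (r, w) \<notin> E)"
  proof
    assume "vertices T = {r}"
    then show "\<forall>w. (r, w) \<notin> E"
      using oriented_edge_in_edges edge_vertices by (metis singletonD)
  next
    assume "\<forall>w. (r, w) \<notin> E"
    then have "v = r" if "(r, v) \<in> E\<^sup>*" for v
      using that by (metis converse_rtranclE)
    then show "vertices T = {r}"
      using vertices_iff root_vertex by blast
  qed
  then show ?thesis
    using True root_vertex by (simp add: leaf_def)
next
  case False
  show ?thesis
  proof (cases "v \<in> vertices T")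
    case True
    then obtain u where u: "(u, v) \<in> E"
      using False parentE by blast
    have eq: "{e \<in> edges T. v \<in> e} = insert {u, v} ((\<lambda>w. {v, w}) ` {w. (v, w) \<in> E})"
    proof (intro equalityI subsetI)
      fix e assume e: "e \<in> {e \<in> edges T. v \<in> e}"
      then have "e \<in> edges T" "v \<in> e" by auto
      then obtain w where w: "e = {v, w}"
        using rooted_tree by (auto simp: rooted_tree_def)
      then show "e \<in> insert {u, v} ((\<lambda>w. {v, w}) ` {w. (v, w) \<in> E})"
        using edge_oriented[of v w] \<open>e \<in> edges T\<close> parent_unique[OF u, of w]
        by (auto simp: insert_commute)
    qed (use u oriented_edge_in_edges in auto)
    \<comment> \<open>The parent edge must not coincide, as an unordered pair, with a child edge:
      the root path of \<open>u\<close> would then run through \<open>v\<close>, against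
      uniqueness.\<close>
    have "u \<noteq> w" if vw: "(v, w) \<in> E" for w
    proof
      assume "u = w"
      obtain p where p: "simple_path T (p @ [u, v])" "hd (p @ [u, v]) = r"
        using u by (rule oriented_edgeE)
      obtain q where q: "simple_path T (q @ [v, u])" "hd (q @ [v, u]) = r"
        using oriented_edgeE[OF vw] \<open>u = w\<close> by metis
      have "simple_path T (p @ [u])"
        using p by (auto simp: simple_path_append simple_path_Cons split: if_splits)
      moreover have "hd (p @ [u]) = r"
        using p by (simp add: hd_append split: if_splits)
      ultimately have "q @ [v, u] = p @ [u]"
        using q no_cycle by (intro simple_path_unique) auto
      then show False
        using p by (auto simp: simple_path_def)
    qed
    then have "{u, v} \<notin> (\<lambda>w. {v, w}) ` {w. (v, w) \<in> E}"
      using edge_vertices(3)[OF oriented_edge_in_edges] by (auto simp: doubleton_eq_iff)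
    then have "card {e \<in> edges T. v \<in> e} = 1 \<longleftrightarrow> (\<lambda>w. {v, w}) ` {w. (v, w) \<in> E} = {}"
      unfolding eq One_nat_def card_1_singleton_iff by auto
    then have "card {e \<in> edges T. v \<in> e} = 1 \<longleftrightarrow> (\<forall>w. (v, w) \<notin> E)"
      by simp
    then show ?thesis
      using True False by (simp add: leaf_def)
  qed (simp add: leaf_def)
qed

end

section \<open>Coordinates on the metric realization\<close>

locale metric_tree = oriented_tree +
  fixes l :: "'a \<times> 'a \<Rightarrow> real"
  assumes length: "length_function T l"
begin

abbreviation "\<Gamma> \<equiv> realization T l"
abbreviation "d \<equiv> path_dist T l"

lemma length_pos: "e \<in> E \<Longrightarrow> 0 < l e"
  using length by (simp add: length_function_def)

section \<open>Root paths as sets of edges\<close>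

lemma vertex_induct [consumes 1, case_names root step]:
  assumes "v \<in> vertices T" "P r"
    and "\<And>u w. u \<in> vertices T \<Longrightarrow> (u, w) \<in> E \<Longrightarrow> P u \<Longrightarrow> P w"
  shows "P v"
proof -
  have "(r, v) \<in> E\<^sup>*"
    using assms(1) vertices_iff by simp
  then show ?thesis
    by induction (use assms vertices_iff in auto)
qed

lemma edge_in_vertices:
  assumes "(u, v) \<in> E"
  shows "u \<in> vertices T" "v \<in> vertices T"
  using edge_vertices[OF oriented_edge_in_edges[OF assms]] by auto

text \<open>This is the edge set of the root path to \<open>v\<close>; as a set it turns comparison
  and branching of paths into inclusion and intersection.\<close>

definition ancestors :: "'a \<Rightarrow> ('a \<times> 'a) set" where
  "ancestors v = {(a, b). (a, b) \<in> E \<and> (b, v) \<in> E\<^sup>*}"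

lemma ancestors_root [simp]: "ancestors r = {}"
  using no_edge_to_root by (auto simp: ancestors_def elim: rtranclE)

lemma ancestors_step:
  assumes "(u, w) \<in> E"
  shows "ancestors w = insert (u, w) (ancestors u)"
proof (intro equalityI subsetI)
  fix e assume "e \<in> ancestors w"
  then obtain a b where e: "e = (a, b)" "(a, b) \<in> E" "(b, w) \<in> E\<^sup>*"
    by (auto simp: ancestors_def)
  from e(3) show "e \<in> insert (u, w) (ancestors u)"
    by (cases rule: rtrancl.cases)
      (use e assms parent_unique in \<open>auto simp: ancestors_def\<close>)
qed (use assms in \<open>auto simp: ancestors_def\<close>)

lemma ancestors_mono: "(v, w) \<in> E\<^sup>* \<Longrightarrow> ancestors v \<subseteq> ancestors w"
  by (auto simp: ancestors_def)

lemma ancestors_edge: "e \<in> ancestors v \<Longrightarrow> e \<in> E"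
  by (auto simp: ancestors_def)

text \<open>A closed walk at \<open>w\<close> enters \<open>w\<close> through its unique parent, so
  it can be pushed back edge by edge to the root, which no edge enters.\<close>

lemma acyclic: "(u, u) \<notin> E\<^sup>+"
proof
  assume "(u, u) \<in> E\<^sup>+"
  then have "u \<in> vertices T"
    using edge_in_vertices by (meson tranclD)
  then have "(u, u) \<notin> E\<^sup>+"
  proof (induction rule: vertex_induct)
    case root
    then show ?case
      using no_edge_to_root by (auto elim: tranclE)
  next
    case (step u w)
    show ?case
    proof
      assume "(w, w) \<in> E\<^sup>+"
      then obtain y where "(w, y) \<in> E\<^sup>*" "(y, w) \<in> E"
        by (meson tranclD2)
      then have "(w, u) \<in> E\<^sup>*"
        using parent_unique step.hyps by metis
      then show False
        using step by (meson rtrancl_into_trancl2)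
    qed
  qed
  then show False
    using \<open>(u, u) \<in> E\<^sup>+\<close> by simp
qed

lemma descendant_antisym: "(u, v) \<in> E\<^sup>* \<Longrightarrow> (v, u) \<in> E\<^sup>* \<Longrightarrow> u = v"
  using acyclic by (metis rtranclD trancl_trans)

lemma edge_notin_ancestors: "(u, w) \<notin> ancestors u"
  using acyclic by (auto simp: ancestors_def) (meson rtrancl_into_trancl2)

lemma finite_ancestors: "v \<in> vertices T \<Longrightarrow> finite (ancestors v)"
  by (induction rule: vertex_induct) (auto simp: ancestors_step)

lemma ancestors_linear:
  "v \<in> vertices T \<Longrightarrow> (a, b) \<in> ancestors v \<Longrightarrow> (a, c) \<in> ancestors v \<Longrightarrow> b = c"
  by (induction rule: vertex_induct) (auto simp: ancestors_step edge_notin_ancestors)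

text \<open>
  The coordinates embed the realization isometrically into \<open>\<ell>\<^sup>1\<close> of the set of edges:
  \<open>coord x e\<close> is the length of the part of \<open>e\<close> that lies between the root and \<open>x\<close>.
\<close>

fun coord :: "'a point \<Rightarrow> 'a \<times> 'a \<Rightarrow> real" where
  "coord (Vertex v) e = (if e \<in> ancestors v then l e else 0)"
| "coord (Interior e' t) e = (if e = e' then t else if e \<in> ancestors (fst e') then l e else 0)"

definition supp :: "'a point \<Rightarrow> ('a \<times> 'a) set" where
  "supp x = {e. coord x e \<noteq> 0}"

definition height :: "'a point \<Rightarrow> real" where
  "height x = (\<Sum>e\<in>supp x. coord x e)"

text \<open>Treating a non-root vertex as the end \<open>t = l (u, v)\<close> of its parent edge
  removes a separate vertex case from what follows.\<close>

lemma realization_cases [consumes 1, case_names root edge]: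
  assumes "x \<in> \<Gamma>"
  obtains "x = Vertex r"
    | u v t where "(u, v) \<in> E" "0 < t" "t \<le> l (u, v)" "x = edge_point l (u, v) t"
proof (cases "x = Vertex r")
  case False
  consider v where "x = Vertex v" "v \<in> vertices T"
    | u v t where "x = Interior (u, v) t" "(u, v) \<in> E" "0 < t" "t < l (u, v)"
    using assms by (auto simp: realization_def)
  then show ?thesis
  proof cases
    case 1
    then obtain u where "(u, v) \<in> E"
      using False parentE by blast
    then show ?thesis
      using 1 length_pos[of "(u, v)"] that(2)[of u v "l (u, v)"] by (simp add: edge_point_def)
  next
    case 2
    then show ?thesis
      using that(2)[of u v t] by (simp add: edge_point_def)
  qed
qed

lemma Vertex_in_realization: "v \<in> vertices T \<Longrightarrow> Vertex v \<in> \<Gamma>"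
  by (simp add: realization_def)

lemma edge_point_in_realization:
  "(u, v) \<in> E \<Longrightarrow> 0 \<le> t \<Longrightarrow> t \<le> l (u, v) \<Longrightarrow> edge_point l (u, v) t \<in> \<Gamma>"
  using edge_in_vertices[of u v] by (auto simp: realization_def edge_point_def)

lemma coord_edge_point:
  assumes "(u, v) \<in> E" "0 \<le> t" "t \<le> l (u, v)"
  shows "coord (edge_point l (u, v) t) e =
    (if e = (u, v) then t else if e \<in> ancestors u then l e else 0)"
  using assms length_pos[of "(u, v)"]
  by (auto simp: edge_point_def ancestors_step[OF assms(1)] edge_notin_ancestors)

lemma ancestors_length_pos: "e \<in> ancestors v \<Longrightarrow> 0 < l e"
  by (intro length_pos ancestors_edge)

lemma supp_Vertex: "supp (Vertex v) = ancestors v"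
  by (auto simp: supp_def dest: ancestors_length_pos)

lemma supp_edge_point:
  assumes "(u, v) \<in> E" "0 < t" "t \<le> l (u, v)"
  shows "supp (edge_point l (u, v) t) = ancestors v"
  using assms
  by (auto simp: supp_def coord_edge_point ancestors_step[OF assms(1)] dest: ancestors_length_pos split: if_splits)

lemma supp_eq_ancestors:
  assumes "x \<in> \<Gamma>"
  obtains v where "v \<in> vertices T" "supp x = ancestors v"
  using assms
proof (cases rule: realization_cases)
  case root
  then show ?thesis
    using that[of r] root_vertex by (simp add: supp_Vertex)
next
  case (edge u v t)
  then show ?thesis
    using that[of v] edge_in_vertices supp_edge_point by blast
qed

lemma finite_supp: "x \<in> \<Gamma> \<Longrightarrow> finite (supp x)"
  by (erule supp_eq_ancestors) (simp add: finite_ancestors)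

lemma coord_bounds: "x \<in> \<Gamma> \<Longrightarrow> e \<in> E \<Longrightarrow> 0 \<le> coord x e \<and> coord x e \<le> l e"
  using length_pos[of e] by (auto elim!: realization_cases simp: coord_edge_point)

lemma supp_edges: "x \<in> \<Gamma> \<Longrightarrow> supp x \<subseteq> E"
  by (erule supp_eq_ancestors) (auto dest: ancestors_edge)

lemma coord_nonneg: "x \<in> \<Gamma> \<Longrightarrow> 0 \<le> coord x e"
  using coord_bounds[of x e] supp_edges[of x] by (cases "e \<in> supp x") (auto simp: supp_def)

lemma supp_mono:
  assumes "x \<in> \<Gamma>" "\<forall>e. coord x e \<le> coord y e"
  shows "supp x \<subseteq> supp y"
proof
  fix e assume "e \<in> supp x"
  then have "0 < coord x e"
    using coord_nonneg[OF assms(1), of e] by (simp add: supp_def)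
  then show "e \<in> supp y"
    using assms(2)[rule_format, of e] by (simp add: supp_def)
qed

lemma height_eq_sum: "finite F \<Longrightarrow> supp x \<subseteq> F \<Longrightarrow> height x = (\<Sum>e\<in>F. coord x e)"
  unfolding height_def by (rule sum.mono_neutral_left) (auto simp: supp_def)

lemma height_Vertex: "height (Vertex v) = (\<Sum>e\<in>ancestors v. l e)"
  by (simp add: height_def supp_Vertex)

lemma height_edge_point:
  assumes "(u, v) \<in> E" "0 < t" "t \<le> l (u, v)"
  shows "height (edge_point l (u, v) t) = height (Vertex u) + t"
proof -
  have "height (edge_point l (u, v) t) = (\<Sum>e\<in>ancestors v. coord (edge_point l (u, v) t) e)"
    using assms by (simp add: height_def supp_edge_point)
  also have "\<dots> = t + (\<Sum>e\<in>ancestors u. coord (edge_point l (u, v) t) e)"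
    using assms finite_ancestors edge_in_vertices[of u v]
    by (simp add: ancestors_step[OF assms(1)] edge_notin_ancestors coord_edge_point)
  also have "(\<Sum>e\<in>ancestors u. coord (edge_point l (u, v) t) e) = height (Vertex u)"
    unfolding height_Vertex using assms
    by (intro sum.cong) (auto simp: coord_edge_point edge_notin_ancestors)
  finally show ?thesis by simp
qed

section \<open>The path metric in edge coordinates\<close>

lemma pl_path_append:
  "pl_path T l x (c @ c') z \<longleftrightarrow> (\<exists>y. pl_path T l x c y \<and> pl_path T l y c' z)"
  by (induction c arbitrary: x) auto

lemma pl_length_append: "pl_length (c @ c') = pl_length c + pl_length c'"
  by (simp add: pl_length_def)

lemma pl_path_rev: "pl_path T l x c y \<Longrightarrow> pl_path T l y (rev (map (\<lambda>(e, s, t). (e, t, s)) c)) x"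
  by (induction c arbitrary: x) (auto simp: pl_path_append)

text \<open>A segment changes only the coordinate of its own edge, by exactly its length; a finite
  \<open>F\<close> keeps the sum meaningful for infinite edge sets.\<close>

lemma pl_length_ge_coord:
  assumes "finite F"
  shows "pl_path T l x c y \<Longrightarrow> (\<Sum>e\<in>F. \<bar>coord x e - coord y e\<bar>) \<le> pl_length c"
proof (induction c arbitrary: x)
  case (Cons a c)
  obtain u v s t where a: "a = ((u, v), s, t)"
    by (metis surj_pair)
  define z where "z = edge_point l (u, v) t"
  have uv: "(u, v) \<in> E" "s \<in> {0..l (u, v)}" "t \<in> {0..l (u, v)}"
    and x: "x = edge_point l (u, v) s" and path: "pl_path T l z c y"
    using Cons.prems by (auto simp: a z_def)
  have "(\<Sum>e\<in>F. \<bar>coord x e - coord y e\<bar>) \<le>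
      (\<Sum>e\<in>F. (if e = (u, v) then \<bar>s - t\<bar> else 0) + \<bar>coord z e - coord y e\<bar>)"
    using uv by (intro sum_mono) (auto simp: x z_def coord_edge_point)
  also have "\<dots> \<le> \<bar>s - t\<bar> + (\<Sum>e\<in>F. \<bar>coord z e - coord y e\<bar>)"
    using assms by (simp add: sum.distrib)
  also have "\<dots> \<le> \<bar>s - t\<bar> + pl_length c"
    using Cons.IH[OF path] by simp
  finally show ?case
    by (simp add: a pl_length_def)
qed (simp add: pl_length_def)

text \<open>The assumption on \<open>u\<close> is the induction hypothesis of
  \<open>monotone_path_to_Vertex\<close>; isolated like this, the step serves vertices and interior
  points.\<close>

lemma monotone_path_to_edge_point:
  assumes uw: "(u, w) \<in> E" "0 < t" "t \<le> l (u, w)"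
    and to_u: "\<And>x. x \<in> \<Gamma> \<Longrightarrow> \<forall>e. coord x e \<le> coord (Vertex u) e \<Longrightarrow>
      \<exists>c. pl_path T l x c (Vertex u) \<and> pl_length c = height (Vertex u) - height x"
    and x: "x \<in> \<Gamma>" and le: "\<forall>e. coord x e \<le> coord (edge_point l (u, w) t) e"
  shows "\<exists>c. pl_path T l x c (edge_point l (u, w) t) \<and>
    pl_length c = height (edge_point l (u, w) t) - height x"
\<comment> \<open>If \<open>x\<close> has already entered the last edge, one segment suffices;
  otherwise its coordinates are bounded by those of \<open>u\<close> and the path goes through
  \<open>u\<close>.\<close>
proof (cases "(u, w) \<in> supp x")
  case True
  show ?thesis
    using x
  proof (cases rule: realization_cases)
    case root
    then show ?thesis
      using True by (simp add: supp_def)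
  next
    case (edge a b s)
    have "ancestors b \<subseteq> ancestors w"
      using supp_mono[OF x le] edge uw by (simp add: supp_edge_point)
    then have "(a, b) \<in> ancestors w"
      using edge ancestors_step[of a b] by auto
    moreover have "(u, w) \<in> ancestors b"
      using True edge by (simp add: supp_edge_point)
    ultimately have "b = w"
      by (auto simp: ancestors_def intro: descendant_antisym)
    then have "a = u"
      using edge uw parent_unique by blast
    have "s \<le> t"
      using le[rule_format, of "(u, w)"] edge uw \<open>a = u\<close> \<open>b = w\<close> by (simp add: coord_edge_point)
    then show ?thesis
      using edge uw \<open>a = u\<close> \<open>b = w\<close>
      by (intro exI[of _ "[((u, w), s, t)]"]) (simp add: pl_length_def height_edge_point)
  qed
next
  case False
  have "coord x e \<le> coord (Vertex u) e" for e
    using False le[rule_format, of e] uw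
    by (cases "e = (u, w)") (auto simp: supp_def coord_edge_point edge_notin_ancestors)
  then obtain c where c: "pl_path T l x c (Vertex u)" "pl_length c = height (Vertex u) - height x"
    using to_u x by blast
  show ?thesis
  proof (intro exI conjI)
    show "pl_path T l x (c @ [((u, w), 0, t)]) (edge_point l (u, w) t)"
      using c uw length_pos[of "(u, w)"] by (auto simp: pl_path_append edge_point_def)
    show "pl_length (c @ [((u, w), 0, t)]) = height (edge_point l (u, w) t) - height x"
      using c uw by (simp add: pl_length_append height_edge_point) (simp add: pl_length_def)
  qed
qed

lemma monotone_path_to_Vertex:
  assumes "v \<in> vertices T" "x \<in> \<Gamma>" "\<forall>e. coord x e \<le> coord (Vertex v) e"
  shows "\<exists>c. pl_path T l x c (Vertex v) \<and> pl_length c = height (Vertex v) - height x"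
  using assms
proof (induction arbitrary: x rule: vertex_induct)
  case root
  show ?case
    using root(1)
  proof (cases rule: realization_cases)
    case root
    then show ?thesis
      by (intro exI[of _ "[]"]) (simp add: pl_length_def)
  next
    case (edge u v t)
    then show ?thesis
      using root(2)[rule_format, of "(u, v)"] by (simp add: coord_edge_point)
  qed
next
  case (step u w)
  have "edge_point l (u, w) (l (u, w)) = Vertex w"
    using length_pos[OF step.hyps(2)] by (simp add: edge_point_def)
  then show ?case
    using monotone_path_to_edge_point[OF step.hyps(2) length_pos[OF step.hyps(2)] order.refl
      step.IH step.prems(1)] step.prems(2) by simp
qed

lemma monotone_path:
  assumes "x \<in> \<Gamma>" "y \<in> \<Gamma>" "\<forall>e. coord x e \<le> coord y e"
  shows "\<exists>c. pl_path T l x c y \<and> pl_length c = height y - height x"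
  using assms(2)
proof (cases rule: realization_cases)
  case root
  then show ?thesis
    using monotone_path_to_Vertex assms root_vertex by blast
next
  case (edge u v t)
  then show ?thesis
    using monotone_path_to_edge_point[OF edge(1-3) monotone_path_to_Vertex] edge_in_vertices assms
    by simp
qed

text \<open>The monotone path attains the coordinate lower bound for \<open>F = supp y\<close>, so
  the infimum is a minimum.\<close>

lemma path_dist_monotone:
  assumes "x \<in> \<Gamma>" "y \<in> \<Gamma>" "\<forall>e. coord x e \<le> coord y e"
  shows "d x y = height y - height x"
  unfolding path_dist_def
proof (rule cInf_eq_minimum)
  show "height y - height x \<in> {pl_length c |c. pl_path T l x c y}"
    using monotone_path[OF assms] by force
next
  fix a assume "a \<in> {pl_length c |c. pl_path T l x c y}"
  then obtain c where c: "pl_path T l x c y" "a = pl_length c"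
    by auto
  have fin: "finite (supp y)"
    using assms(2) by (rule finite_supp)
  have "height y - height x = (\<Sum>e\<in>supp y. coord y e - coord x e)"
    using height_eq_sum[OF fin] supp_mono[OF assms(1,3)] by (simp add: sum_subtractf)
  also have "\<dots> \<le> (\<Sum>e\<in>supp y. \<bar>coord x e - coord y e\<bar>)"
    by (intro sum_mono) auto
  also have "\<dots> \<le> a"
    using pl_length_ge_coord[OF fin c(1)] c(2) by simp
  finally show "height y - height x \<le> a" .
qed

lemma path_dist_root:
  assumes "x \<in> \<Gamma>"
  shows "d (Vertex r) x = height x"
  using path_dist_monotone[OF Vertex_in_realization[OF root_vertex] assms] coord_nonneg[OF assms]
  by (simp add: height_Vertex)

lemma path_dist_ge_coord:
  assumes "x \<in> \<Gamma>" "y \<in> \<Gamma>" "finite F"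
  shows "(\<Sum>e\<in>F. \<bar>coord x e - coord y e\<bar>) \<le> d x y"
  unfolding path_dist_def
proof (rule cInf_greatest)
  \<comment> \<open>Two paths from the root, one of them reversed, join \<open>x\<close> to
    \<open>y\<close>, so the infimum is not taken over the empty set.\<close>
  have "\<exists>c. pl_path T l (Vertex r) c z" if "z \<in> \<Gamma>" for z
    using monotone_path[OF Vertex_in_realization[OF root_vertex] that] coord_nonneg[OF that] by auto
  then obtain c c' where "pl_path T l (Vertex r) c x" "pl_path T l (Vertex r) c' y"
    using assms by blast
  then have "pl_path T l x (rev (map (\<lambda>(e, s, t). (e, t, s)) c) @ c') y"
    using pl_path_rev pl_path_append by blast
  then show "{pl_length c |c. pl_path T l x c y} \<noteq> {}"
    by blast
next
  fix a assume "a \<in> {pl_length c |c. pl_path T l x c y}"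
  then show "(\<Sum>e\<in>F. \<bar>coord x e - coord y e\<bar>) \<le> a"
    using pl_length_ge_coord[OF assms(3)] by blast
qed

text \<open>The order of \<open>\<Gamma>\<close> with the root as least element is encoded in the metric.\<close>

lemma path_dist_additive_iff:
  assumes "x \<in> \<Gamma>" "y \<in> \<Gamma>"
  shows "d (Vertex r) y = d (Vertex r) x + d x y \<longleftrightarrow> (\<forall>e. coord x e \<le> coord y e)"
proof
  assume "d (Vertex r) y = d (Vertex r) x + d x y"
  then have eq: "d x y = height y - height x"
    using assms by (simp add: path_dist_root)
  have "coord x e \<le> coord y e" for e
  proof -
    define F where "F = insert e (supp x \<union> supp y)"
    have fin: "finite F"
      using assms finite_supp by (simp add: F_def)
    have "height y = (\<Sum>e\<in>F. coord y e)" "height x = (\<Sum>e\<in>F. coord x e)"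
      by (rule height_eq_sum[OF fin], force simp: F_def)+
    \<comment> \<open>The lower bound sums absolute values, the height difference signed ones;
      equality forces every nonnegative defect to vanish, in particular at \<open>e\<close>.\<close>
    then have "(\<Sum>e\<in>F. \<bar>coord x e - coord y e\<bar> - (coord y e - coord x e)) \<le> 0"
      using path_dist_ge_coord[OF assms fin] eq by (simp add: sum_subtractf)
    moreover have "0 \<le> (\<Sum>e\<in>F. \<bar>coord x e - coord y e\<bar> - (coord y e - coord x e))"
      by (intro sum_nonneg) auto
    ultimately have "(\<Sum>e\<in>F. \<bar>coord x e - coord y e\<bar> - (coord y e - coord x e)) = 0"
      by (rule order.antisym)
    moreover have "e \<in> F"
      by (simp add: F_def)
    ultimately have "\<bar>coord x e - coord y e\<bar> - (coord y e - coord x e) = 0"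
      using sum_nonneg_eq_0_iff[OF fin, of "\<lambda>e. \<bar>coord x e - coord y e\<bar> - (coord y e - coord x e)"]
      by simp
    then show ?thesis
      by linarith
  qed
  then show "\<forall>e. coord x e \<le> coord y e" ..
next
  assume le: "\<forall>e. coord x e \<le> coord y e"
  show "d (Vertex r) y = d (Vertex r) x + d x y"
    using path_dist_monotone[OF assms le] path_dist_root[OF assms(1)] path_dist_root[OF assms(2)]
    by linarith
qed

end

section \<open>Maximal chains and the extended boundary\<close>

text \<open>Here \<open>b\<close> is the number of edges of the path, so \<open>s i\<close> matters only for \<open>i \<le> b\<close>.\<close>

fun to_path :: "(nat \<Rightarrow> 'v) \<Rightarrow> enat \<Rightarrow> 'v oriented_path" where
  "to_path s \<infinity> = Ray s"
| "to_path s (enat n) = Segment (map s [0..<Suc n])"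

lemma path_edges_to_path: "path_edges (to_path s b) = {(s i, s (Suc i)) | i. enat i < b}"
proof (cases b)
  case (enat n)
  have "set (zip (map s [0..<Suc n]) (tl (map s [0..<Suc n]))) = {(s i, s (Suc i)) | i. i < n}"
    by (force simp: set_zip nth_tl simp del: upt_Suc)
  then show ?thesis
    using enat by simp
qed auto

context metric_tree
begin

text \<open>Rays (\<open>b = \<infinity>\<close>) and paths to a leaf share one form; by
  \<open>leaf_iff\<close> the last clause is the leaf condition.\<close>

definition track :: "(nat \<Rightarrow> 'a) \<Rightarrow> enat \<Rightarrow> bool" where
  "track s b \<longleftrightarrow> s 0 = r \<and> (\<forall>i. enat i < b \<longrightarrow> (s i, s (Suc i)) \<in> E) \<and>
     (\<forall>n w. b = enat n \<longrightarrow> (s n, w) \<notin> E)"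

lemma track_reachable:
  assumes "s 0 = r" "\<And>i. enat i < b \<Longrightarrow> (s i, s (Suc i)) \<in> E"
  shows "enat i \<le> b \<Longrightarrow> (r, s i) \<in> E\<^sup>*"
proof (induction i)
  case (Suc i)
  then have "enat i < b"
    by (simp add: Suc_ile_eq)
  then show ?case
    using Suc.IH assms(2)[of i] by (simp add: order_less_imp_le rtrancl_into_rtrancl)
qed (use assms in simp)

lemma extended_boundary_iff: "\<rho> \<in> extended_boundary T \<longleftrightarrow> (\<exists>s b. track s b \<and> \<rho> = to_path s b)"
proof
  assume "\<rho> \<in> extended_boundary T"
  then consider s where "\<rho> = Ray s" "s 0 = r" "\<forall>i. (s i, s (Suc i)) \<in> E"
    | p where "\<rho> = Segment p" "p \<noteq> []" "hd p = r" "leaf T (last p)"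
      "successively (\<lambda>u v. (u, v) \<in> E) p"
    by (auto simp: extended_boundary_def boundary_def)
  then show "\<exists>s b. track s b \<and> \<rho> = to_path s b"
  proof cases
    case 1
    then show ?thesis
      by (intro exI[of _ s] exI[of _ \<infinity>]) (simp add: track_def)
  next
    case 2
    define n where "n = length p - 1"
    have len: "length p = Suc n"
      using 2 by (simp add: n_def)
    have "track ((!) p) (enat n)"
      using 2 len leaf_iff[of "last p"]
      by (auto simp: track_def successively_conv_nth hd_conv_nth last_conv_nth)
    moreover have "\<rho> = to_path ((!) p) (enat n)"
      using 2 len map_nth[of p] by simp
    ultimately show ?thesis by blast
  qed
next
  assume "\<exists>s b. track s b \<and> \<rho> = to_path s b"
  then obtain s b where sb: "track s b" "\<rho> = to_path s b"
    by blast
  show "\<rho> \<in> extended_boundary T"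
  proof (cases b)
    case (enat n)
    let ?p = "map s [0..<Suc n]"
    have "s n \<in> vertices T"
      using track_reachable[of s b n] sb enat by (auto simp: track_def vertices_iff)
    then have "leaf T (last ?p)"
      using sb enat by (simp add: leaf_iff track_def)
    moreover have "hd ?p = r"
      using sb by (simp add: track_def hd_conv_nth nth_append del: upt_Suc)
    moreover have "successively (\<lambda>u v. (u, v) \<in> E) ?p"
      using sb enat by (auto simp: track_def successively_conv_nth simp del: upt_Suc)
    ultimately show ?thesis
      using sb enat by (simp add: extended_boundary_def)
  next
    case infinity
    then show ?thesis
      using sb by (auto simp: extended_boundary_def boundary_def track_def)
  qed
qed

lemma ancestors_track:
  assumes "track s b"
  shows "enat i \<le> b \<Longrightarrow> ancestors (s i) = {(s j, s (Suc j)) | j. j < i}"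
proof (induction i)
  case 0
  then show ?case
    using assms by (simp add: track_def)
next
  case (Suc i)
  then have "enat i < b"
    by (simp add: Suc_ile_eq)
  then have "ancestors (s (Suc i)) = insert (s i, s (Suc i)) (ancestors (s i))"
    using assms by (intro ancestors_step) (simp add: track_def)
  then show ?case
    using Suc.IH \<open>enat i < b\<close> by (auto simp: less_Suc_eq)
qed

text \<open>The last clause makes \<open>S\<close> maximal: it continues as long as the tree does.\<close>

definition branch :: "('a \<times> 'a) set \<Rightarrow> bool" where
  "branch S \<longleftrightarrow> S \<subseteq> E \<and> (\<forall>u v. (u, v) \<in> S \<longrightarrow> ancestors v \<subseteq> S) \<and>
     (\<forall>u v w. (u, v) \<in> S \<longrightarrow> (u, w) \<in> S \<longrightarrow> v = w) \<and>
     (\<forall>v\<in>vertices T. ancestors v \<subseteq> S \<longrightarrow> (\<exists>w. (v, w) \<in> E) \<longrightarrow> (\<exists>w. (v, w) \<in> S))"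

lemma branchD:
  assumes "branch S"
  shows "S \<subseteq> E"
    and "(u, v) \<in> S \<Longrightarrow> ancestors v \<subseteq> S"
    and "(u, v) \<in> S \<Longrightarrow> (u, w) \<in> S \<Longrightarrow> v = w"
    and "v \<in> vertices T \<Longrightarrow> ancestors v \<subseteq> S \<Longrightarrow> (v, w) \<in> E \<Longrightarrow> \<exists>w. (v, w) \<in> S"
  using assms unfolding branch_def by blast+

lemma branch_ancestors:
  assumes "branch S" "(u, v) \<in> S"
  shows "ancestors u \<subseteq> S"
proof -
  have "(u, v) \<in> E"
    using branchD(1)[OF assms(1)] assms(2) by blast
  then show ?thesis
    using branchD(2)[OF assms] ancestors_mono[of u v] by blast
qed

lemma branch_track:
  assumes "track s b"
  shows "branch (path_edges (to_path s b))"
proof -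
  let ?S = "path_edges (to_path s b)"
  have S: "?S = {(s i, s (Suc i)) | i. enat i < b}"
    by (rule path_edges_to_path)
  have sub: "?S \<subseteq> E"
    using assms by (auto simp: S track_def)
  have anc: "ancestors (s i) \<subseteq> ?S" if "enat i \<le> b" for i
  proof -
    have "enat j < b" if "j < i" for j
      using that \<open>enat i \<le> b\<close> by (metis enat_ord_simps(2) order_less_le_trans)
    then show ?thesis
      using ancestors_track[OF assms that] by (auto simp: S)
  qed
  have vert: "s i \<in> vertices T" if "enat i \<le> b" for i
    using track_reachable[of s b i] assms that by (auto simp: track_def vertices_iff)
  \<comment> \<open>Both edges lie on the root path of \<open>s (Suc j)\<close>, where
    \<open>ancestors_linear\<close> permits one edge per starting vertex.\<close>
  have lin: "s (Suc i) = s (Suc j)" if "i \<le> j" "enat j < b" "s i = s j" for i j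
  proof -
    have "enat (Suc j) \<le> b"
      using that by (simp add: Suc_ile_eq)
    then have "(s i, s (Suc i)) \<in> ancestors (s (Suc j))" "(s j, s (Suc j)) \<in> ancestors (s (Suc j))"
      using ancestors_track[OF assms, of "Suc j"] that by (fastforce simp: less_Suc_eq_le)+
    then show ?thesis
      using ancestors_linear[OF vert[OF \<open>enat (Suc j) \<le> b\<close>]] that by metis
  qed
  show ?thesis
    unfolding branch_def
  proof (intro conjI allI impI ballI sub)
    fix u v assume "(u, v) \<in> ?S"
    then obtain i where "enat i < b" "v = s (Suc i)"
      by (auto simp: S)
    then show "ancestors v \<subseteq> ?S"
      using anc by (simp add: Suc_ile_eq)
  next
    fix u v w assume "(u, v) \<in> ?S" "(u, w) \<in> ?S"
    then obtain i j where "enat i < b" "enat j < b" "u = s i" "s i = s j" "v = s (Suc i)" "w = s (Suc j)"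
      by (auto simp: S)
    moreover have "i \<le> j \<or> j \<le> i"
      by (rule nat_le_linear)
    ultimately show "v = w"
      using lin by metis
  next
    fix v assume v: "v \<in> vertices T" "ancestors v \<subseteq> ?S" "\<exists>w. (v, w) \<in> E"
    have "\<exists>i. enat i \<le> b \<and> v = s i"
    proof (cases "v = r")
      case True
      then show ?thesis
        using assms by (intro exI[of _ 0]) (simp add: track_def zero_enat_def[symmetric])
    next
      case False
      then obtain u where u: "(u, v) \<in> E"
        using v(1) parentE by blast
      then have "(u, v) \<in> ?S"
        using v(2) ancestors_step[OF u] by auto
      then obtain i where "enat i < b" "v = s (Suc i)"
        by (auto simp: S)
      then show ?thesis
        by (intro exI[of _ "Suc i"]) (simp add: Suc_ile_eq)
    qed
    then obtain i where i: "enat i \<le> b" "v = s i"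
      by blast
    \<comment> \<open>A track of length \<open>i\<close> would end at a childless vertex, but
      \<open>v\<close> has a child.\<close>
    have "b \<noteq> enat i"
      using v(3) i assms by (auto simp: track_def)
    then show "\<exists>w. (v, w) \<in> ?S"
      using i by (auto simp: S)
  qed
qed

lemma branch_path_edges: "\<rho> \<in> extended_boundary T \<Longrightarrow> branch (path_edges \<rho>)"
  by (auto simp: extended_boundary_iff branch_track)

text \<open>The edge set determines the track step by step: only one of its edges leaves
  \<open>s i\<close>, and the other track cannot stop there since \<open>s i\<close> has a
  child.\<close>

lemma track_agree:
  assumes s: "track s b" and s': "track s' b'"
    and eq: "path_edges (to_path s b) = path_edges (to_path s' b')"
  shows "enat i \<le> b \<Longrightarrow> enat i \<le> b' \<and> s' i = s i"
proof (induction i)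
  case 0
  then show ?case
    using s s' by (simp add: track_def zero_enat_def[symmetric])
next
  case (Suc i)
  then have i: "enat i < b" "enat i \<le> b'" "s' i = s i"
    by (auto simp: Suc_ile_eq)
  then have e: "(s i, s (Suc i)) \<in> path_edges (to_path s b)" "(s i, s (Suc i)) \<in> E"
    using s by (auto simp: path_edges_to_path track_def)
  then have "b' \<noteq> enat i"
    using i s' by (auto simp: track_def)
  then have "enat i < b'"
    using i by auto
  then have "(s i, s' (Suc i)) \<in> path_edges (to_path s b)"
    unfolding eq using i by (force simp: path_edges_to_path)
  then have "s' (Suc i) = s (Suc i)"
    using branchD(3)[OF branch_track[OF s]] e by blast
  then show ?case
    using \<open>enat i < b'\<close> by (simp add: Suc_ile_eq)
qed

lemma enat_leI:
  fixes a b :: enat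
  assumes "\<And>i. enat i \<le> a \<Longrightarrow> enat i \<le> b"
  shows "a \<le> b"
proof (cases b)
  case (enat n)
  have "\<not> enat (Suc n) \<le> a"
  proof
    assume "enat (Suc n) \<le> a"
    then have "enat (Suc n) \<le> b"
      by (rule assms)
    then show False
      using enat by simp
  qed
  then show ?thesis
    using enat by (simp add: Suc_ile_eq not_less)
qed simp

text \<open>Lets elements of the extended boundary be handled through their edge sets, which are
  branches.\<close>

lemma inj_on_path_edges: "inj_on path_edges (extended_boundary T)"
proof (rule inj_onI)
  fix \<rho> \<tau> assume "\<rho> \<in> extended_boundary T" "\<tau> \<in> extended_boundary T"
    and eq: "path_edges \<rho> = path_edges \<tau>"
  then obtain s b s' b' where s: "track s b" "\<rho> = to_path s b" and s': "track s' b'" "\<tau> = to_path s' b'"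
    unfolding extended_boundary_iff by blast
  have agree: "enat i \<le> b' \<and> s' i = s i" if "enat i \<le> b" for i
    using track_agree[OF s(1) s'(1)] eq s(2) s'(2) that by simp
  have "enat i \<le> b" if "enat i \<le> b'" for i
    using track_agree[OF s'(1) s(1)] eq s(2) s'(2) that by simp
  then have "b = b'"
    using agree by (blast intro: order.antisym enat_leI)
  show "\<rho> = \<tau>"
  proof (cases b)
    case (enat n)
    then have "map s [0..<Suc n] = map s' [0..<Suc n]"
      using agree by (simp add: less_Suc_eq_le del: upt_Suc)
    then show ?thesis
      unfolding s(2) s'(2) \<open>b = b'\<close>[symmetric] enat by (simp only: to_path.simps)
  next
    case infinity
    then have "s' i = s i" for i
      using agree[of i] by simp
    then have "s' = s" ..
    then show ?thesis
      using s(2) s'(2) \<open>b = b'\<close> by simp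
  qed
qed

section \<open>Branches as maximal chains of points\<close>

definition comparable :: "'a point \<Rightarrow> 'a point \<Rightarrow> bool" where
  "comparable x y \<longleftrightarrow> (\<forall>e. coord x e \<le> coord y e) \<or> (\<forall>e. coord y e \<le> coord x e)"

text \<open>For a branch this is the part of \<open>\<Gamma>\<close> swept out by the path;
  containing interior points as well as vertices, it can be transported by an isometry.\<close>

definition points :: "('a \<times> 'a) set \<Rightarrow> 'a point set" where
  "points S = {x \<in> \<Gamma>. supp x \<subseteq> S}"

text \<open>A branch leaves each vertex by at most one edge, so the root paths of \<open>v\<close>
  and \<open>w\<close> cannot part.\<close>

lemma branch_vertices_comparable:
  assumes S: "branch S" and v: "v \<in> vertices T" "ancestors v \<subseteq> S"
    and w: "w \<in> vertices T" "ancestors w \<subseteq> S"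
  shows "(v, w) \<in> E\<^sup>* \<or> (w, v) \<in> E\<^sup>*"
  using v
proof (induction rule: vertex_induct)
  case root
  then show ?case
    using w vertices_iff by blast
next
  case (step u v)
  then have "(u, v) \<in> S" "ancestors u \<subseteq> S"
    using ancestors_step[OF step.hyps(2)] by auto
  then consider "(u, w) \<in> E\<^sup>*" | "(w, u) \<in> E\<^sup>*"
    using step.IH by blast
  then show ?case
  proof cases
    case 1
    then show ?thesis
    proof (cases rule: converse_rtranclE)
      case base
      then show ?thesis
        using step.hyps by blast
    next
      case (step v')
      then have "(u, v') \<in> S"
        using w by (auto simp: ancestors_def)
      then show ?thesis
        using branchD(3)[OF S \<open>(u, v) \<in> S\<close>] step by blast
    qed
  next
    case 2
    then show ?thesis
      using step.hyps by (meson rtrancl_into_rtrancl)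
  qed
qed

lemma coord_mono_of_edge:
  assumes x: "x \<in> \<Gamma>" "(u, v) \<in> E" "0 \<le> t" "t \<le> l (u, v)" and sub: "supp x \<subseteq> ancestors v"
    and le: "coord x (u, v) \<le> t"
  shows "coord x e \<le> coord (edge_point l (u, v) t) e"
proof (cases "e \<in> supp x")
  case True
  then have "coord x e \<le> l e"
    using coord_bounds[OF x(1)] supp_edges[OF x(1)] by blast
  then show ?thesis
    using True sub le ancestors_step[OF x(2)] by (auto simp: coord_edge_point[OF x(2-4)])
next
  case False
  then show ?thesis
    using coord_nonneg[OF edge_point_in_realization[OF x(2-4)]] by (simp add: supp_def)
qed

lemma points_comparable:
  assumes S: "branch S" and "x \<in> points S" "y \<in> points S"
  shows "comparable x y"
proof -
  \<comment> \<open>With the edge of \<open>x\<close> ending no farther along the branch than that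
    of \<open>y\<close>, the order can be reversed only if both points lie on the same edge.\<close>
  have wlog: "comparable x y"
    if xy: "x \<in> points S" "y \<in> points S" and v: "supp x = ancestors v" and w: "supp y = ancestors w"
      and vw: "(v, w) \<in> E\<^sup>*" for x y v w
  proof -
    have "y \<in> \<Gamma>" "x \<in> \<Gamma>"
      using xy by (auto simp: points_def)
    from \<open>y \<in> \<Gamma>\<close> show ?thesis
    proof (cases rule: realization_cases)
      case root
      then show ?thesis
        using coord_nonneg[OF \<open>x \<in> \<Gamma>\<close>] by (simp add: comparable_def)
    next
      case (edge a b t)
      note y = edge
      have sub: "supp x \<subseteq> ancestors b"
        using y v w vw ancestors_mono[OF vw] supp_edge_point[OF y(1-3)] by simp
      show ?thesis
      proof (cases "coord x (a, b) \<le> t")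
        case True
        then show ?thesis
          using coord_mono_of_edge[OF \<open>x \<in> \<Gamma>\<close> y(1) _ y(3) sub] y by (auto simp: comparable_def)
      next
        case False
        then have "(a, b) \<in> supp x"
          using y by (auto simp: supp_def)
        from \<open>x \<in> \<Gamma>\<close> show ?thesis
        proof (cases rule: realization_cases)
          case root
          then show ?thesis
            using False y by simp
        next
          case (edge a' b' s)
          have "ancestors b' \<subseteq> ancestors b" "(a, b) \<in> ancestors b'"
            using sub \<open>(a, b) \<in> supp x\<close> edge by (auto simp: supp_edge_point)
          then have "b' = b"
            using ancestors_step[OF edge(1)]
            by (auto simp: ancestors_def intro: descendant_antisym)
          moreover have "a' = a"
            using parent_unique edge(1) y(1) \<open>b' = b\<close> by blast
          ultimately have "coord y e \<le> coord x e" for e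
            using False y edge by (auto simp: coord_edge_point)
          then show ?thesis
            by (simp add: comparable_def)
        qed
      qed
    qed
  qed
  have "x \<in> \<Gamma>" "y \<in> \<Gamma>"
    using assms by (auto simp: points_def)
  then obtain v w where v: "v \<in> vertices T" "supp x = ancestors v"
    and w: "w \<in> vertices T" "supp y = ancestors w"
    using supp_eq_ancestors by metis
  then have "ancestors v \<subseteq> S" "ancestors w \<subseteq> S"
    using assms by (auto simp: points_def)
  then have "(v, w) \<in> E\<^sup>* \<or> (w, v) \<in> E\<^sup>*"
    using branch_vertices_comparable[OF S] v w by blast
  then show ?thesis
    using wlog[of x y v w] wlog[of y x w v] assms v w by (auto simp: comparable_def)
qed

lemma first_edge_outside:
  assumes "v \<in> vertices T" "\<not> ancestors v \<subseteq> S"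
  obtains z w where "(z, w) \<in> ancestors v" "(z, w) \<notin> S" "ancestors z \<subseteq> S" "z \<in> vertices T"
proof -
  have "\<not> ancestors v \<subseteq> S \<longrightarrow>
    (\<exists>z w. (z, w) \<in> ancestors v \<and> (z, w) \<notin> S \<and> ancestors z \<subseteq> S \<and> z \<in> vertices T)"
    using assms(1)
  proof (induction rule: vertex_induct)
    case (step u w)
    note anc = ancestors_step[OF step.hyps(2)]
    show ?case
    proof (cases "ancestors u \<subseteq> S")
      case True
      then show ?thesis
        using step.hyps anc by auto
    next
      case False
      then show ?thesis
        using step.IH anc by blast
    qed
  qed simp
  then show ?thesis
    using assms(2) that by blast
qed

text \<open>If the root path of \<open>x\<close> left the branch at \<open>z\<close>, the branch
  would continue from \<open>z\<close> by another edge, whose far end is not comparable with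
  \<open>x\<close>.\<close>

lemma points_maximal:
  assumes S: "branch S" and x: "x \<in> \<Gamma>" and comp: "\<And>y. y \<in> points S \<Longrightarrow> comparable x y"
  shows "x \<in> points S"
proof (rule ccontr)
  assume "x \<notin> points S"
  obtain v where v: "v \<in> vertices T" "supp x = ancestors v"
    using x by (rule supp_eq_ancestors)
  then have "\<not> ancestors v \<subseteq> S"
    using x \<open>x \<notin> points S\<close> by (simp add: points_def)
  with v(1) obtain z w where zw: "(z, w) \<in> ancestors v" "(z, w) \<notin> S"
    and z: "ancestors z \<subseteq> S" "z \<in> vertices T"
    by (rule first_edge_outside)
  obtain w' where w': "(z, w') \<in> S"
    using branchD(4)[OF S z(2,1)] ancestors_edge[OF zw(1)] by blast
  then have "(z, w') \<in> E"
    using branchD(1)[OF S] by blast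
  then have anc_w': "ancestors w' \<subseteq> S" "w' \<in> vertices T" "(z, w') \<in> ancestors w'"
    using branchD(2)[OF S w'] edge_in_vertices[of z w'] ancestors_step[of z w'] by auto
  then have "Vertex w' \<in> points S"
    by (simp add: points_def Vertex_in_realization supp_Vertex)
  then have "comparable x (Vertex w')"
    by (rule comp)
  then have "supp x \<subseteq> supp (Vertex w') \<or> supp (Vertex w') \<subseteq> supp x"
    using supp_mono[OF x] supp_mono[OF Vertex_in_realization[OF anc_w'(2)]]
    unfolding comparable_def by blast
  then have "supp x \<subseteq> ancestors w' \<or> ancestors w' \<subseteq> supp x"
    by (simp add: supp_Vertex)
  then show False
  proof
    assume "supp x \<subseteq> ancestors w'"
    then show False
      using zw v anc_w' by auto
  next
    assume "ancestors w' \<subseteq> supp x"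
    then have "w = w'"
      using v zw anc_w' ancestors_linear by blast
    then show False
      using zw w' by simp
  qed
qed

text \<open>Walk from the root, taking an edge used by the chain whenever one leaves the current
  vertex and any edge otherwise. The walk may outrun the chain, but stops only at a childless
  vertex.\<close>

lemma chain_extends_to_branch:
  assumes C: "C \<subseteq> \<Gamma>" and comp: "\<And>x y. x \<in> C \<Longrightarrow> y \<in> C \<Longrightarrow> comparable x y"
  obtains \<rho> where "\<rho> \<in> extended_boundary T" "C \<subseteq> points (path_edges \<rho>)"
proof -
  define D where "D = (\<Union>x\<in>C. supp x)"
  define child where "child v = (SOME w. (v, w) \<in> E \<and> ((\<exists>w'. (v, w') \<in> D) \<longrightarrow> (v, w) \<in> D))" for v
  have DE: "D \<subseteq> E"
    using C supp_edges by (auto simp: D_def)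
  have child: "(v, child v) \<in> E \<and> ((\<exists>w'. (v, w') \<in> D) \<longrightarrow> (v, child v) \<in> D)" if "(v, w) \<in> E" for v w
  proof -
    have "\<exists>w. (v, w) \<in> E \<and> ((\<exists>w'. (v, w') \<in> D) \<longrightarrow> (v, w) \<in> D)"
      using that DE by blast
    then show ?thesis
      unfolding child_def by (rule someI_ex)
  qed
  define s where "s i = (child ^^ i) r" for i
  define childless where "childless i \<longleftrightarrow> (\<forall>w. (s i, w) \<notin> E)" for i
  \<comment> \<open>Past the first childless vertex \<open>child\<close> is unspecified;
    \<open>b\<close> cuts the sequence there.\<close>
  define b where "b = (if \<exists>i. childless i then enat (LEAST i. childless i) else \<infinity>)"
  have "track s b"
    unfolding track_def
  proof (intro conjI allI impI)
    fix i assume "enat i < b"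
    then have "\<not> childless i"
      by (auto simp: b_def dest: not_less_Least split: if_splits)
    then show "(s i, s (Suc i)) \<in> E"
      using child by (auto simp: childless_def s_def)
  next
    fix n w assume "b = enat n"
    then have "childless n"
      by (auto simp: b_def intro: LeastI split: if_splits)
    then show "(s n, w) \<notin> E"
      by (simp add: childless_def)
  qed (simp add: s_def)
  define S where "S = path_edges (to_path s b)"
  have S: "branch S"
    unfolding S_def by (rule branch_track) fact
  have S_child: "w = child v" if "(v, w) \<in> S" for v w
    using that by (auto simp: S_def path_edges_to_path s_def)
  \<comment> \<open>Supports of comparable points are nested, so two edges of \<open>D\<close> out
    of \<open>v\<close> lie on one root path.\<close>
  have D_linear: "w = w'" if w: "(v, w) \<in> D" "(v, w') \<in> D" for v w w'
  proof -
    obtain x y where xy: "x \<in> C" "(v, w) \<in> supp x" "y \<in> C" "(v, w') \<in> supp y"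
      using w by (auto simp: D_def)
    then have "supp x \<subseteq> supp y \<or> supp y \<subseteq> supp x"
      using comp[OF xy(1,3)] supp_mono C unfolding comparable_def by blast
    then obtain z where z: "z \<in> C" "(v, w) \<in> supp z" "(v, w') \<in> supp z"
      using xy by blast
    obtain u where "u \<in> vertices T" "supp z = ancestors u"
      using C z supp_eq_ancestors by blast
    then show ?thesis
      using z ancestors_linear by blast
  qed
  have sub: "ancestors v \<subseteq> D \<longrightarrow> ancestors v \<subseteq> S" if "v \<in> vertices T" for v
    using that
  proof (induction rule: vertex_induct)
    case (step u w)
    show ?case
    proof
      assume w: "ancestors w \<subseteq> D"
      then have u: "ancestors u \<subseteq> S" "(u, w) \<in> D"
        using step.IH ancestors_step[OF step.hyps(2)] by auto
      then obtain w' where w': "(u, w') \<in> S"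
        using branchD(4)[OF S step.hyps(1) _ step.hyps(2)] by blast
      then have "(u, w') \<in> D"
        using child[OF step.hyps(2)] S_child[OF w'] u by auto
      then have "w = w'"
        using D_linear u by blast
      then show "ancestors w \<subseteq> S"
        using ancestors_step[OF step.hyps(2)] u w' by auto
    qed
  qed simp
  have "C \<subseteq> points S"
  proof
    fix x assume "x \<in> C"
    then obtain v where "v \<in> vertices T" "supp x = ancestors v"
      using C supp_eq_ancestors by blast
    moreover have "supp x \<subseteq> D"
      using \<open>x \<in> C\<close> by (auto simp: D_def)
    ultimately show "x \<in> points S"
      using sub[of v] C \<open>x \<in> C\<close> by (auto simp: points_def)
  qed
  then show ?thesis
    using that[of "to_path s b"] \<open>track s b\<close> extended_boundary_iff S_def by blast
qed

text \<open>Follow the root path of an edge in only one branch to its first exit from the other, at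
  \<open>z\<close>. A common edge beyond \<open>z\<close> would put an edge out of \<open>z\<close>
  into both branches, and it would have to be the exit edge.\<close>

lemma branch_meet:
  assumes S: "branch S" and S': "branch S'" and "S \<noteq> S'"
  obtains z where "z \<in> vertices T" "S \<inter> S' = ancestors z"
proof -
  have wlog: "\<exists>z\<in>vertices T. S \<inter> S' = ancestors z"
    if S: "branch S" and S': "branch S'" and e: "(a, b) \<in> S" "(a, b) \<notin> S'" for S S' a b
  proof -
    have "(a, b) \<in> E"
      using e branchD(1)[OF S] by blast
    then have "b \<in> vertices T" "\<not> ancestors b \<subseteq> S'"
      using e edge_in_vertices[of a b] ancestors_step[of a b] by auto
    then obtain z w where zw: "(z, w) \<in> ancestors b" "(z, w) \<notin> S'"
      and z: "ancestors z \<subseteq> S'" "z \<in> vertices T"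
      by (rule first_edge_outside)
    have zw_S: "(z, w) \<in> S"
      using zw branchD(2)[OF S e(1)] by blast
    then have anc_S: "ancestors z \<subseteq> S"
      by (rule branch_ancestors[OF S])
    have "S \<inter> S' \<subseteq> ancestors z"
    proof
      fix f assume "f \<in> S \<inter> S'"
      then obtain c d where f: "f = (c, d)" "(c, d) \<in> S" "(c, d) \<in> S'"
        by (cases f) auto
      have cd: "(c, d) \<in> E"
        using f branchD(1)[OF S] by blast
      have "d \<in> vertices T" "ancestors d \<subseteq> S"
        using edge_in_vertices[OF cd] branchD(2)[OF S f(2)] by auto
      then consider "(d, z) \<in> E\<^sup>*" | "(z, d) \<in> E\<^sup>*"
        using branch_vertices_comparable[OF S _ _ z(2) anc_S] by blast
      then show "f \<in> ancestors z"
      proof cases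
        case 1
        then show ?thesis
          using f cd by (simp add: ancestors_def)
      next
        case 2
        then show ?thesis
        proof (cases rule: converse_rtranclE)
          case base
          then show ?thesis
            using f cd by (simp add: ancestors_def)
        next
          case (step w')
          then have "(z, w') \<in> ancestors d"
            by (simp add: ancestors_def)
          then have "(z, w') \<in> S" "(z, w') \<in> S'"
            using branchD(2)[OF S f(2)] branchD(2)[OF S' f(3)] by auto
          then show ?thesis
            using branchD(3)[OF S zw_S] zw by auto
        qed
      qed
    qed
    then show ?thesis
      using z anc_S by blast
  qed
  consider a b where "(a, b) \<in> S" "(a, b) \<notin> S'" | a b where "(a, b) \<in> S'" "(a, b) \<notin> S"
    using \<open>S \<noteq> S'\<close> by auto
  then have "\<exists>z\<in>vertices T. S \<inter> S' = ancestors z"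
  proof cases
    case 1
    then show ?thesis
      by (rule wlog[OF S S'])
  next
    case 2
    then have "\<exists>z\<in>vertices T. S' \<inter> S = ancestors z"
      by (rule wlog[OF S' S])
    then show ?thesis
      by (simp add: Int_commute)
  qed
  then show ?thesis
    using that by blast
qed

end

section \<open>Pairings, greedy runs and isometries\<close>

context metric_tree
begin

lemma points_subset_iff:
  assumes "branch S"
  shows "points S \<subseteq> points S' \<longleftrightarrow> S \<subseteq> S'"
proof
  assume sub: "points S \<subseteq> points S'"
  show "S \<subseteq> S'"
  proof
    fix e assume "e \<in> S"
    obtain u v where e: "e = (u, v)"
      by (cases e)
    have uv: "(u, v) \<in> E" "ancestors v \<subseteq> S"
      using \<open>e \<in> S\<close> e branchD(1,2)[OF assms] by auto
    then have "Vertex v \<in> points S"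
      using Vertex_in_realization[OF edge_in_vertices(2)[OF uv(1)]] by (simp add: points_def supp_Vertex)
    then have "Vertex v \<in> points S'"
      using sub by blast
    then have "ancestors v \<subseteq> S'"
      by (simp add: points_def supp_Vertex)
    then show "e \<in> S'"
      using ancestors_step[OF uv(1)] e by auto
  qed
qed (auto simp: points_def)

text \<open>Distinct elements have distinct branches, which part at a vertex; so the pairing is a
  finite sum and a height, a quantity visible to the metric.\<close>

lemma pairing_meet:
  assumes "\<rho> \<in> extended_boundary T" "\<tau> \<in> extended_boundary T" "\<rho> \<noteq> \<tau>"
  obtains z where "z \<in> vertices T" "path_edges \<rho> \<inter> path_edges \<tau> = ancestors z"
    "pairing l \<rho> \<tau> = height (Vertex z)"
proof -
  have "path_edges \<rho> \<noteq> path_edges \<tau>"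
    using assms inj_on_path_edges by (auto dest: inj_onD)
  then obtain z where "z \<in> vertices T" "path_edges \<rho> \<inter> path_edges \<tau> = ancestors z"
    using branch_meet[OF branch_path_edges[OF assms(1)] branch_path_edges[OF assms(2)]] by blast
  then show ?thesis
    using that[of z] by (simp add: pairing_def height_Vertex)
qed

lemma height_le_pairing:
  assumes "\<rho> \<in> extended_boundary T" "\<tau> \<in> extended_boundary T" "\<rho> \<noteq> \<tau>"
    and "x \<in> points (path_edges \<rho>)" "x \<in> points (path_edges \<tau>)"
  shows "height x \<le> pairing l \<rho> \<tau>"
proof -
  obtain z where z: "z \<in> vertices T" "path_edges \<rho> \<inter> path_edges \<tau> = ancestors z"
    "pairing l \<rho> \<tau> = height (Vertex z)"
    using assms(1-3) by (rule pairing_meet)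
  have x: "x \<in> \<Gamma>" "supp x \<subseteq> ancestors z"
    using assms(4,5) z(2) by (auto simp: points_def)
  have "height x = (\<Sum>e\<in>ancestors z. coord x e)"
    by (rule height_eq_sum[OF finite_ancestors[OF z(1)] x(2)])
  also have "\<dots> \<le> (\<Sum>e\<in>ancestors z. l e)"
    using coord_bounds[OF x(1)] ancestors_edge by (intro sum_mono) blast
  finally show ?thesis
    by (simp add: z height_Vertex)
qed

text \<open>Both intersections are root paths of vertices on the branch of \<open>\<rho>\<close>,
  and such vertices are comparable.\<close>

lemma meets_nested:
  assumes "\<rho> \<in> extended_boundary T" "\<sigma> \<in> extended_boundary T" "\<tau> \<in> extended_boundary T"
    "\<rho> \<noteq> \<sigma>" "\<rho> \<noteq> \<tau>"
  shows "path_edges \<rho> \<inter> path_edges \<sigma> \<subseteq> path_edges \<rho> \<inter> path_edges \<tau> \<or>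
    path_edges \<rho> \<inter> path_edges \<tau> \<subseteq> path_edges \<rho> \<inter> path_edges \<sigma>"
proof -
  obtain a where a: "a \<in> vertices T" "path_edges \<rho> \<inter> path_edges \<sigma> = ancestors a"
    using pairing_meet[OF assms(1,2,4)] by blast
  obtain b where b: "b \<in> vertices T" "path_edges \<rho> \<inter> path_edges \<tau> = ancestors b"
    using pairing_meet[OF assms(1,3,5)] by blast
  have "(a, b) \<in> E\<^sup>* \<or> (b, a) \<in> E\<^sup>*"
    using branch_vertices_comparable[OF branch_path_edges[OF assms(1)]] a b by blast
  then show ?thesis
    unfolding a(2) b(2) using ancestors_mono by blast
qed

lemma finite_meet:
  assumes "\<rho> \<in> extended_boundary T" "\<tau> \<in> extended_boundary T" "\<rho> \<noteq> \<tau>"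
  shows "finite (path_edges \<rho> \<inter> path_edges \<tau>)"
  by (rule pairing_meet[OF assms]) (simp add: finite_ancestors)

lemma path_edges_length_pos:
  assumes "\<rho> \<in> extended_boundary T" "e \<in> path_edges \<rho>"
  shows "0 < l e"
  using branchD(1)[OF branch_path_edges[OF assms(1)]] assms(2) length_pos by blast

lemma pairing_mono:
  assumes "\<rho>' \<in> extended_boundary T" "\<tau>' \<in> extended_boundary T" "\<rho>' \<noteq> \<tau>'"
    and "path_edges \<rho> \<inter> path_edges \<tau> \<subseteq> path_edges \<rho>' \<inter> path_edges \<tau>'"
  shows "pairing l \<rho> \<tau> \<le> pairing l \<rho>' \<tau>'"
  unfolding pairing_def
  using finite_meet[OF assms(1-3)] assms(4)
proof (rule sum_mono2)
  show "0 \<le> l e" if "e \<in> path_edges \<rho>' \<inter> path_edges \<tau>' - path_edges \<rho> \<inter> path_edges \<tau>" for e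
    using that path_edges_length_pos[OF assms(1), of e] by simp
qed

lemma pairing_ultrametric: "separated_ultrametric (extended_boundary T) (pairing l)"
  unfolding separated_ultrametric_def
proof (intro conjI ballI impI)
  fix \<rho> \<tau> assume "\<rho> \<in> extended_boundary T"
  then show "0 \<le> pairing l \<rho> \<tau>"
    unfolding pairing_def by (intro sum_nonneg) (auto simp: path_edges_length_pos less_imp_le)
next
  fix \<rho> \<tau> :: "'a oriented_path"
  show "pairing l \<rho> \<tau> = pairing l \<tau> \<rho>"
    by (simp add: pairing_def Int_commute)
next
  fix x y z assume B: "x \<in> extended_boundary T" "y \<in> extended_boundary T" "z \<in> extended_boundary T"
    and ne: "x \<noteq> y" "y \<noteq> z" "x \<noteq> z"
  \<comment> \<open>Both meets lie on \<open>y\<close>, so the smaller one is contained in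
    \<open>x\<close> and in \<open>z\<close>.\<close>
  have "path_edges y \<inter> path_edges x \<subseteq> path_edges y \<inter> path_edges z \<or>
      path_edges y \<inter> path_edges z \<subseteq> path_edges y \<inter> path_edges x"
    using B ne by (intro meets_nested) auto
  then have "path_edges x \<inter> path_edges y \<subseteq> path_edges x \<inter> path_edges z \<or>
      path_edges y \<inter> path_edges z \<subseteq> path_edges x \<inter> path_edges z"
    by auto
  then show "min (pairing l x y) (pairing l y z) \<le> pairing l x z"
    using pairing_mono[OF B(1,3) ne(3)] by (meson min.coboundedI1 min.coboundedI2)
qed

text \<open>The meets with \<open>\<rho>\<close> are nested finite sets, so one of least cardinality
  lies in all the others. Edges are counted because their lengths may be arbitrarily small.\<close>

lemma pairing_minimum_exists:
  assumes "\<rho> \<in> extended_boundary T" "S \<subseteq> extended_boundary T - {\<rho>}" "S \<noteq> {}"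
  shows "\<exists>\<sigma>\<in>S. \<forall>\<tau>\<in>S. pairing l \<sigma> \<rho> \<le> pairing l \<tau> \<rho>"
proof -
  obtain \<sigma> where \<sigma>: "\<sigma> \<in> S"
    "\<And>\<tau>. \<tau> \<in> S \<Longrightarrow> card (path_edges \<rho> \<inter> path_edges \<sigma>) \<le> card (path_edges \<rho> \<inter> path_edges \<tau>)"
    using ex_has_least_nat[of "\<lambda>\<sigma>. \<sigma> \<in> S" _ "\<lambda>\<sigma>. card (path_edges \<rho> \<inter> path_edges \<sigma>)"] assms(3)
    by (metis all_not_in_conv)
  have "pairing l \<sigma> \<rho> \<le> pairing l \<tau> \<rho>" if "\<tau> \<in> S" for \<tau>
  proof -
    have B: "\<sigma> \<in> extended_boundary T" "\<tau> \<in> extended_boundary T" "\<rho> \<noteq> \<sigma>" "\<rho> \<noteq> \<tau>"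
      using \<sigma>(1) that assms(2) by auto
    have "path_edges \<rho> \<inter> path_edges \<sigma> \<subseteq> path_edges \<rho> \<inter> path_edges \<tau>"
      using meets_nested[OF assms(1) B]
    proof
      assume "path_edges \<rho> \<inter> path_edges \<tau> \<subseteq> path_edges \<rho> \<inter> path_edges \<sigma>"
      then have "path_edges \<rho> \<inter> path_edges \<tau> = path_edges \<rho> \<inter> path_edges \<sigma>"
        using finite_meet[OF assms(1) B(1,3)] \<sigma>(2)[OF that] by (intro card_seteq) auto
      then show ?thesis by simp
    qed
    then show ?thesis
      using B assms(1) by (intro pairing_mono) auto
  qed
  then show ?thesis
    using \<sigma>(1) by blast
qed

section \<open>Length and energy of greedy runs\<close>

lemma greedy_choice_iff:
  "\<sigma> \<in> greedy_choices T l \<rho> n \<longleftrightarrow> \<sigma> \<in> extended_boundary T - \<rho> ` {..<n} \<and>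
     (\<forall>\<tau>\<in>extended_boundary T - \<rho> ` {..<n}.
        (\<Sum>j<n. pairing l \<sigma> (\<rho> j)) \<le> (\<Sum>j<n. pairing l \<tau> (\<rho> j)))"
  by (auto simp: greedy_choices_def is_arg_min_def not_less)

lemma greedy_run_choice:
  "greedy_run T l \<rho> N \<Longrightarrow> enat n < N \<Longrightarrow> \<rho> n \<in> greedy_choices T l \<rho> n"
  by (simp add: greedy_run_def)

lemma greedy_run_inj:
  assumes "greedy_run T l \<rho> N" "enat n \<le> N"
  shows "inj_on \<rho> {..<n}" "\<rho> ` {..<n} \<subseteq> extended_boundary T"
proof -
  have new: "\<rho> k \<in> extended_boundary T - \<rho> ` {..<k}" if "k < n" for k
  proof -
    have "enat k < N"
      using that assms(2) by (metis enat_ord_simps(2) order_less_le_trans)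
    then show ?thesis
      using greedy_run_choice[OF assms(1)] greedy_choice_iff by blast
  qed
  then show "\<rho> ` {..<n} \<subseteq> extended_boundary T"
    by blast
  show "inj_on \<rho> {..<n}"
  proof (rule linorder_inj_onI)
    fix i j :: nat assume "i < j" "i \<in> {..<n}" "j \<in> {..<n}"
    then show "\<rho> i \<noteq> \<rho> j"
      using new[of j] by (metis DiffD2 imageI lessThan_iff)
  qed auto
qed

text \<open>As long as an element is left a minimizer exists, so a run stops only when the extended
  boundary is exhausted.\<close>

lemma greedy_run_length:
  assumes run: "greedy_run T l \<rho> N"
  shows "N = (if finite (extended_boundary T) then enat (card (extended_boundary T)) else \<infinity>)"
proof (cases N)
  case (enat n)
  note inj = greedy_run_inj[OF run, of n]
  have "extended_boundary T - \<rho> ` {..<n} = {}"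
  proof (rule ccontr)
    assume "extended_boundary T - \<rho> ` {..<n} \<noteq> {}"
    from ultrametric_minimizer_exists[OF pairing_ultrametric _ _ this pairing_minimum_exists]
    obtain \<sigma> where "\<sigma> \<in> extended_boundary T - \<rho> ` {..<n}"
      "\<forall>\<tau>\<in>extended_boundary T - \<rho> ` {..<n}.
        (\<Sum>\<rho>\<in>\<rho> ` {..<n}. pairing l \<sigma> \<rho>) \<le> (\<Sum>\<rho>\<in>\<rho> ` {..<n}. pairing l \<tau> \<rho>)"
      using inj enat by auto
    then have "\<sigma> \<in> greedy_choices T l \<rho> n"
      using inj(1) enat by (simp add: greedy_choice_iff sum.reindex)
    then show False
      using run enat by (auto simp: greedy_run_def)
  qed
  then have "extended_boundary T = \<rho> ` {..<n}"
    using inj enat by auto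
  then show ?thesis
    using inj(1) enat by (simp add: card_image)
next
  case infinity
  have "infinite (extended_boundary T)"
  proof
    assume fin: "finite (extended_boundary T)"
    define n where "n = Suc (card (extended_boundary T))"
    have "card (\<rho> ` {..<n}) \<le> card (extended_boundary T)"
      using greedy_run_inj(2)[OF run, of n] infinity fin by (intro card_mono) auto
    moreover have "card (\<rho> ` {..<n}) = n"
      using greedy_run_inj(1)[OF run, of n] infinity by (simp add: card_image)
    ultimately show False
      by (simp add: n_def)
  qed
  then show ?thesis
    using infinity by simp
qed

lemma greedy_energy:
  assumes run: "greedy_run T l \<rho> N" and n: "enat n \<le> N"
  shows "energy (pairing l) (\<rho> ` {..<n}) = (\<Sum>k<n. greedy_value l \<rho> k)"
  using energy_greedy[OF pairing_ultrametric greedy_run_inj[OF assms]]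
  by (simp add: greedy_value_def)

lemma greedy_energy_minimal:
  assumes run: "greedy_run T l \<rho> N" and n: "enat n \<le> N"
    and Y: "finite Y" "Y \<subseteq> extended_boundary T" "card Y = n"
  shows "(\<Sum>k<n. greedy_value l \<rho> k) \<le> energy (pairing l) Y"
  unfolding greedy_value_def
proof (rule greedy_le_energy[OF pairing_ultrametric greedy_run_inj[OF assms(1,2)] _ Y])
  fix k \<sigma> assume "k < n" "\<sigma> \<in> extended_boundary T - \<rho> ` {..<k}"
  moreover have "enat k < N"
    using \<open>k < n\<close> n by (metis enat_ord_simps(2) order_less_le_trans)
  ultimately show "(\<Sum>j<k. pairing l (\<rho> k) (\<rho> j)) \<le> (\<Sum>j<k. pairing l \<sigma> (\<rho> j))"
    using greedy_run_choice[OF run] greedy_choice_iff by blast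
qed

end

text \<open>Comparability and height are metric notions, so \<open>f\<close> carries the chain of
  \<open>\<rho>\<close> into that of some element, which \<open>g\<close> selects. The statement is
  later used for the isometry and for its inverse.\<close>

lemma root_isometric_embeds_boundary:
  assumes "metric_tree T1 l1" "metric_tree T2 l2" "root_isometric T1 l1 T2 l2"
  shows "\<exists>g. inj_on g (extended_boundary T1) \<and> g ` extended_boundary T1 \<subseteq> extended_boundary T2 \<and>
    (\<forall>\<rho>\<in>extended_boundary T1. \<forall>\<tau>\<in>extended_boundary T1. \<rho> \<noteq> \<tau> \<longrightarrow>
      pairing l2 (g \<rho>) (g \<tau>) \<le> pairing l1 \<rho> \<tau>)"
proof -
  interpret M1: metric_tree T1 l1 by fact
  interpret M2: metric_tree T2 l2 by fact
  obtain f where bij: "bij_betw f M1.\<Gamma> M2.\<Gamma>"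
    and dist: "\<And>x y. x \<in> M1.\<Gamma> \<Longrightarrow> y \<in> M1.\<Gamma> \<Longrightarrow> M2.d (f x) (f y) = M1.d x y"
    and root: "f (Vertex M1.r) = Vertex M2.r"
    using assms(3) unfolding root_isometric_def by blast
  have f: "f x \<in> M2.\<Gamma>" if "x \<in> M1.\<Gamma>" for x
    using bij that by (auto simp: bij_betw_def)
  have root1: "Vertex M1.r \<in> M1.\<Gamma>"
    by (intro M1.Vertex_in_realization M1.root_vertex)
  have dist_root: "M2.d (Vertex M2.r) (f x) = M1.d (Vertex M1.r) x" if "x \<in> M1.\<Gamma>" for x
    using dist[OF root1 that] root by simp
  have height: "M2.height (f x) = M1.height x" if "x \<in> M1.\<Gamma>" for x
    using dist_root[OF that] M1.path_dist_root[OF that] M2.path_dist_root[OF f[OF that]] by simp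
  have comparable: "M2.comparable (f x) (f y) \<longleftrightarrow> M1.comparable x y"
    if "x \<in> M1.\<Gamma>" "y \<in> M1.\<Gamma>" for x y
    unfolding M1.comparable_def M2.comparable_def
      M1.path_dist_additive_iff[OF that, symmetric]
      M1.path_dist_additive_iff[OF that(2,1), symmetric]
      M2.path_dist_additive_iff[OF f[OF that(1)] f[OF that(2)], symmetric]
      M2.path_dist_additive_iff[OF f[OF that(2)] f[OF that(1)], symmetric]
    by (simp add: that dist dist_root)
  let ?P1 = "\<lambda>\<rho>. M1.points (path_edges \<rho>)" and ?P2 = "\<lambda>\<rho>. M2.points (path_edges \<rho>)"
  have points1: "?P1 \<rho> \<subseteq> M1.\<Gamma>" for \<rho>
    by (auto simp: M1.points_def)
  have "\<exists>\<tau>. \<tau> \<in> extended_boundary T2 \<and> f ` ?P1 \<rho> \<subseteq> ?P2 \<tau>" if "\<rho> \<in> extended_boundary T1" for \<rho>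
  proof (rule M2.chain_extends_to_branch)
    show "f ` ?P1 \<rho> \<subseteq> M2.\<Gamma>"
      using points1 f by blast
    show "M2.comparable x y" if xy: "x \<in> f ` ?P1 \<rho>" "y \<in> f ` ?P1 \<rho>" for x y
    proof -
      obtain x' y' where "x = f x'" "y = f y'" "x' \<in> ?P1 \<rho>" "y' \<in> ?P1 \<rho>"
        using xy by blast
      then show ?thesis
        using comparable[of x' y'] points1[of \<rho>] subsetD
          M1.points_comparable[OF M1.branch_path_edges[OF \<open>\<rho> \<in> extended_boundary T1\<close>]]
        by blast
    qed
  qed blast
  then obtain g where g: "g \<rho> \<in> extended_boundary T2" "f ` ?P1 \<rho> \<subseteq> ?P2 (g \<rho>)"
    if "\<rho> \<in> extended_boundary T1" for \<rho>
    by metis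
  \<comment> \<open>Maximality of the chain of \<open>\<rho>\<close> turns the inclusion defining
    \<open>g\<close> into an equality of preimages, from which injectivity follows.\<close>
  have pull: "x \<in> ?P1 \<rho>"
    if \<rho>: "\<rho> \<in> extended_boundary T1" and x: "x \<in> M1.\<Gamma>" "f x \<in> ?P2 (g \<rho>)" for x \<rho>
  proof (rule M1.points_maximal[OF M1.branch_path_edges[OF \<rho>] x(1)])
    fix y assume y: "y \<in> ?P1 \<rho>"
    then have "f y \<in> ?P2 (g \<rho>)"
      using g(2)[OF \<rho>] by blast
    then have "M2.comparable (f x) (f y)"
      using M2.points_comparable[OF M2.branch_path_edges[OF g(1)[OF \<rho>]] x(2)] by blast
    then show "M1.comparable x y"
      using comparable x(1) y points1 by blast
  qed
  have points_eq: "?P1 \<rho> = {x \<in> M1.\<Gamma>. f x \<in> ?P2 (g \<rho>)}" if "\<rho> \<in> extended_boundary T1" for \<rho>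
  proof (intro equalityI subsetI)
    fix x assume "x \<in> ?P1 \<rho>"
    then show "x \<in> {x \<in> M1.\<Gamma>. f x \<in> ?P2 (g \<rho>)}"
      using g(2)[OF that] points1 by blast
  qed (use pull[OF that] in blast)
  have inj: "inj_on g (extended_boundary T1)"
  proof (rule inj_onI)
    fix \<rho> \<tau> assume B: "\<rho> \<in> extended_boundary T1" "\<tau> \<in> extended_boundary T1" and eq: "g \<rho> = g \<tau>"
    have "?P1 \<rho> = ?P1 \<tau>"
      using points_eq B eq by simp
    then have "path_edges \<rho> = path_edges \<tau>"
      using M1.points_subset_iff[OF M1.branch_path_edges[OF B(1)], of "path_edges \<tau>"]
        M1.points_subset_iff[OF M1.branch_path_edges[OF B(2)], of "path_edges \<rho>"]
      by simp
    then show "\<rho> = \<tau>"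
      using M1.inj_on_path_edges B by (meson inj_onD)
  qed
  show ?thesis
  proof (intro exI conjI ballI impI)
    show "inj_on g (extended_boundary T1)"
      by (rule inj)
    show "g ` extended_boundary T1 \<subseteq> extended_boundary T2"
      using g(1) by blast
  next
    fix \<rho> \<tau> assume B: "\<rho> \<in> extended_boundary T1" "\<tau> \<in> extended_boundary T1" and ne: "\<rho> \<noteq> \<tau>"
    then have "g \<rho> \<noteq> g \<tau>"
      using inj inj_onD by metis
    then obtain z where z: "z \<in> vertices T2" "path_edges (g \<rho>) \<inter> path_edges (g \<tau>) = M2.ancestors z"
      "pairing l2 (g \<rho>) (g \<tau>) = M2.height (Vertex z)"
      using M2.pairing_meet[OF g(1)[OF B(1)] g(1)[OF B(2)]] by blast
    \<comment> \<open>The preimage of the branching vertex may be interior to an edge, but it lies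
      on both branches of \<open>T1\<close> at the same height.\<close>
    have "Vertex z \<in> M2.\<Gamma>"
      using z(1) by (rule M2.Vertex_in_realization)
    then have "Vertex z \<in> f ` M1.\<Gamma>"
      using bij_betw_imp_surj_on[OF bij] by simp
    then obtain x where x: "x \<in> M1.\<Gamma>" "f x = Vertex z"
      by (metis imageE)
    have "f x \<in> ?P2 (g \<rho>)" "f x \<in> ?P2 (g \<tau>)"
      using \<open>Vertex z \<in> M2.\<Gamma>\<close>
      by (simp_all add: x(2) M2.points_def M2.supp_Vertex z(2)[symmetric])
    then have "x \<in> ?P1 \<rho>" "x \<in> ?P1 \<tau>"
      using points_eq B x(1) by simp_all
    then have "M1.height x \<le> pairing l1 \<rho> \<tau>"
      using M1.height_le_pairing[OF B ne] by blast
    then show "pairing l2 (g \<rho>) (g \<tau>) \<le> pairing l1 \<rho> \<tau>"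
      using height[OF x(1)] x(2) z(3) by simp
  qed
qed

lemma root_isometric_sym:
  assumes "rooted_tree T1" "root_isometric T1 l1 T2 l2"
  shows "root_isometric T2 l2 T1 l1"
proof -
  obtain f where bij: "bij_betw f (realization T1 l1) (realization T2 l2)"
    and dist: "\<And>x y. x \<in> realization T1 l1 \<Longrightarrow> y \<in> realization T1 l1 \<Longrightarrow>
      path_dist T2 l2 (f x) (f y) = path_dist T1 l1 x y"
    and root: "f (Vertex (tree_root T1)) = Vertex (tree_root T2)"
    using assms(2) unfolding root_isometric_def by blast
  define h where "h = inv_into (realization T1 l1) f"
  have h: "bij_betw h (realization T2 l2) (realization T1 l1)"
    unfolding h_def using bij by (rule bij_betw_inv_into)
  have fh: "f (h y) = y" "h y \<in> realization T1 l1" if "y \<in> realization T2 l2" for y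
    using bij_betw_inv_into_right[OF bij that] bij_betwE[OF h] that by (auto simp: h_def)
  have "Vertex (tree_root T1) \<in> realization T1 l1"
    using assms(1) by (simp add: realization_def rooted_tree_def)
  then have "h (Vertex (tree_root T2)) = Vertex (tree_root T1)"
    using bij_betw_inv_into_left[OF bij] root by (metis h_def)
  then show ?thesis
    unfolding root_isometric_def using h fh dist by (metis (no_types, lifting))
qed

lemma energy_image_le:
  assumes "finite Y" "inj_on g Y"
    and "\<And>x y. x \<in> Y \<Longrightarrow> y \<in> Y \<Longrightarrow> x \<noteq> y \<Longrightarrow> q (g x) (g y) \<le> p x y"
  shows "energy q (g ` Y) \<le> energy p Y"
proof -
  have "(\<Sum>z\<in>g ` Y - {g y}. q (g y) z) = (\<Sum>z\<in>Y - {y}. q (g y) (g z))" if "y \<in> Y" for y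
  proof -
    have "g ` Y - {g y} = g ` (Y - {y})"
      using assms(2) that by (auto dest: inj_onD)
    then show ?thesis
      using inj_on_subset[OF assms(2), of "Y - {y}"] by (simp add: sum.reindex)
  qed
  then have "(\<Sum>y\<in>g ` Y. \<Sum>z\<in>g ` Y - {y}. q y z) = (\<Sum>y\<in>Y. \<Sum>z\<in>Y - {y}. q (g y) (g z))"
    using assms(2) by (simp add: sum.reindex)
  also have "\<dots> \<le> (\<Sum>y\<in>Y. \<Sum>z\<in>Y - {y}. p y z)"
    using assms(3) by (intro sum_mono) auto
  finally show ?thesis
    by (simp add: energy_def)
qed

text \<open>The image under \<open>g\<close> of the first \<open>n\<close> choices in
  \<open>T1\<close> is a competitor in \<open>T2\<close>, of no greater energy.\<close>

lemma greedy_partial_sums_le: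
  assumes "metric_tree T1 l1" "metric_tree T2 l2" "root_isometric T1 l1 T2 l2"
    and "greedy_run T1 l1 \<rho> N" "greedy_run T2 l2 \<rho>' N'" "enat n \<le> N" "enat n \<le> N'"
  shows "(\<Sum>k<n. greedy_value l2 \<rho>' k) \<le> (\<Sum>k<n. greedy_value l1 \<rho> k)"
proof -
  interpret M1: metric_tree T1 l1 by fact
  interpret M2: metric_tree T2 l2 by fact
  obtain g where g: "inj_on g (extended_boundary T1)" "g ` extended_boundary T1 \<subseteq> extended_boundary T2"
    "\<forall>\<rho>\<in>extended_boundary T1. \<forall>\<tau>\<in>extended_boundary T1. \<rho> \<noteq> \<tau> \<longrightarrow>
      pairing l2 (g \<rho>) (g \<tau>) \<le> pairing l1 \<rho> \<tau>"
    using root_isometric_embeds_boundary[OF assms(1-3)] by blast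
  define Y where "Y = \<rho> ` {..<n}"
  have inj: "inj_on \<rho> {..<n}" and Y: "Y \<subseteq> extended_boundary T1" "finite Y"
    using M1.greedy_run_inj[OF assms(4,6)] by (auto simp: Y_def)
  have inj_g: "inj_on g Y"
    using g(1) Y(1) by (rule inj_on_subset)
  have "card (g ` Y) = n"
    using inj inj_g by (simp add: Y_def card_image)
  then have "(\<Sum>k<n. greedy_value l2 \<rho>' k) \<le> energy (pairing l2) (g ` Y)"
    using Y g(2) by (intro M2.greedy_energy_minimal[OF assms(5,7)]) auto
  also have "\<dots> \<le> energy (pairing l1) Y"
    using Y inj_g g(3) by (intro energy_image_le) auto
  also have "\<dots> = (\<Sum>k<n. greedy_value l1 \<rho> k)"
    unfolding Y_def by (rule M1.greedy_energy[OF assms(4,6)])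
  finally show ?thesis .
qed

theorem theorem1p1:
  fixes T1 :: "'v rooted_graph" and l1 :: "'v \<times> 'v \<Rightarrow> real"
    and T2 :: "'w rooted_graph" and l2 :: "'w \<times> 'w \<Rightarrow> real"
    and \<rho> :: "nat \<Rightarrow> 'v oriented_path" and \<rho>' :: "nat \<Rightarrow> 'w oriented_path"
    and N N' :: enat
  assumes "rooted_tree T1" and "length_function T1 l1"
    and "rooted_tree T2" and "length_function T2 l2"
    and "root_isometric T1 l1 T2 l2"
    and "greedy_run T1 l1 \<rho> N" and "greedy_run T2 l2 \<rho>' N'"
  shows "N = N' \<and> (\<forall>n. enat n < N \<longrightarrow> greedy_value l1 \<rho> n = greedy_value l2 \<rho>' n)"
proof -
  have M1: "metric_tree T1 l1" and M2: "metric_tree T2 l2"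
    using assms by unfold_locales
  have iso': "root_isometric T2 l2 T1 l1"
    using assms(1,5) by (rule root_isometric_sym)
  obtain g where g: "inj_on g (extended_boundary T1)" "g ` extended_boundary T1 \<subseteq> extended_boundary T2"
    using root_isometric_embeds_boundary[OF M1 M2 assms(5)] by blast
  obtain h where h: "inj_on h (extended_boundary T2)" "h ` extended_boundary T2 \<subseteq> extended_boundary T1"
    using root_isometric_embeds_boundary[OF M2 M1 iso'] by blast
  \<comment> \<open>Injections in both directions equate the cardinalities, and these determine the
    lengths of the runs.\<close>
  have "finite (extended_boundary T1) \<longleftrightarrow> finite (extended_boundary T2)"
    using g h by (metis inj_on_finite)
  moreover have "card (extended_boundary T1) = card (extended_boundary T2)"
    if "finite (extended_boundary T1)" "finite (extended_boundary T2)"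
    using that g h by (metis card_bij_eq)
  ultimately have eq: "N = N'"
    using metric_tree.greedy_run_length[OF M1 assms(6)]
      metric_tree.greedy_run_length[OF M2 assms(7)] by simp
  have sums: "(\<Sum>k<n. greedy_value l1 \<rho> k) = (\<Sum>k<n. greedy_value l2 \<rho>' k)" if "enat n \<le> N" for n
    using greedy_partial_sums_le[OF M1 M2 assms(5-7)] greedy_partial_sums_le[OF M2 M1 iso' assms(7,6)]
      that eq by (intro order.antisym) auto
  \<comment> \<open>The value is the difference of the sums over \<open>k < n\<close> and
    \<open>k < Suc n\<close>; the latter is covered because \<open>enat n < N\<close> means
    \<open>enat (Suc n) \<le> N\<close>.\<close>
  have "greedy_value l1 \<rho> n = greedy_value l2 \<rho>' n" if "enat n < N" for n
    using sums[of n] sums[of "Suc n"] that by (simp add: Suc_ile_eq order_less_imp_le)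
  then show ?thesis
    using eq by blast
qed

end
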